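(* Let $m\ge 1$ and let $f,f_1,\dots,f_m:(0,\infty)\to\mathbb{R}$ be convex functions with $f(1)=f_1(1)=\dots=f_m(1)=0$. For every $D_1,\dots,D_m\ge 0$ we have $$A(D_1,\dots,D_m)=A_{m+2}(D_1,\dots,D_m).$$ Further, if the divergences $D_{f_1},\dots,D_{f_m}$ are all finite, then $$B(D_1,\dots,D_m)=B_{m+2}(D_1,\dots,D_m).$$
   Context: For a convex function $f:(0,\infty)\to\mathbb{R}$ with $f(1)=0$, put $f(0):=\lim_{x\downarrow 0}f(x)$ and $f'(\infty):=\lim_{x\uparrow\infty}f(x)/x$ (both exist, possibly $+\infty$). For probability measures $P,Q$ on a common measurable space with densities $p,q$ with respect to a common dominating measure $\lambda$, the $f$-divergence is $D_f(P||Q):=\int_{\{q>0\}} f(p/q)\,dQ+f'(\infty)P\{q=0\}$ (with $\infty\cdot 0=0$); it does not depend on $\lambda$. The divergence $D_f$ is called finite if $\sup_{P,Q}D_f(P||Q)<\infty$, the supremum being over all pairs of probability measures on all possible measurable spaces. Given $f,f_1,\dots,f_m$ and nonnegative real numbers $D_1,\dots,D_m$, define $A(D_1,\dots,D_m):=\sup\{D_f(P||Q): D_{f_i}(P||Q)\le D_i\ \forall i\}$ and $B(D_1,\dots,D_m):=\inf\{D_f(P||Q): D_{f_i}(P||Q)\ge D_i\ \forall i\}$, where $(P,Q)$ ranges over all pairs of probability measures on all possible measurable spaces. For $n\ge1$, $\mathcal{P}_n$ denotes the set of all probability measures on $\{1,\dots,n\}$, and $A_n(D_1,\dots,D_m)$,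 $B_n(D_1,\dots,D_m)$ denote the same supremum and infimum with $(P,Q)$ restricted to $P,Q\in\mathcal{P}_n$. *)

theory Defs
  imports "HOL-Probability.Probability"
begin

text \<open>
  Only the values of a generator \<open>f :: real \<Rightarrow> real\<close> on \<open>(0, \<infinity>)\<close> are ever used.  For convex \<open>f\<close>
  both limits below exist in \<open>(-\<infinity>, \<infinity>]\<close>.
\<close>

definition value_at_0 :: "(real \<Rightarrow> real) \<Rightarrow> ereal" where
  "value_at_0 f = Lim (at_right 0) (\<lambda>x. ereal (f x))"

definition slope_at_infinity :: "(real \<Rightarrow> real) \<Rightarrow> ereal" where
  "slope_at_infinity f = Lim at_top (\<lambda>x. ereal (f x / x))"

definition extend_to_0 :: "(real \<Rightarrow> real) \<Rightarrow> real \<Rightarrow> ereal" where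
  "extend_to_0 f x = (if 0 < x then ereal (f x) else value_at_0 f)"

text \<open>
  The Lebesgue integral of an extended-real function as positive part minus negative part
  (\<open>e2ennreal\<close> maps negative numbers to 0).  Where it is used below, the negative part has a
  finite integral, since a convex function is bounded below by an affine one.
\<close>

definition ereal_integral :: "'a measure \<Rightarrow> ('a \<Rightarrow> ereal) \<Rightarrow> ereal" where
  "ereal_integral M g =
     enn2ereal (\<integral>\<^sup>+ x. e2ennreal (g x) \<partial>M) - enn2ereal (\<integral>\<^sup>+ x. e2ennreal (- g x) \<partial>M)"

definition f_divergence_densities ::
    "(real \<Rightarrow> real) \<Rightarrow> 'a measure \<Rightarrow> 'a measure \<Rightarrow> ('a \<Rightarrow> real) \<Rightarrow> ('a \<Rightarrow> real) \<Rightarrow> ereal" where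
  "f_divergence_densities f P Q p q =
     ereal_integral Q (\<lambda>x. if 0 < q x then extend_to_0 f (p x / q x) else 0)
     + slope_at_infinity f * ereal (measure P {x \<in> space P. q x = 0})"

definition sum_measure :: "'a measure \<Rightarrow> 'a measure \<Rightarrow> 'a measure" where
  "sum_measure P Q = measure_of (space P) (sets P) (\<lambda>A. emeasure P A + emeasure Q A)"

text \<open>
  The divergence is computed with the particular dominating measure \<open>P + Q\<close>; the theorem
  \<open>f_divergence_eq\<close> below shows that every other choice gives the same value.
\<close>

definition f_divergence :: "(real \<Rightarrow> real) \<Rightarrow> 'a measure \<Rightarrow> 'a measure \<Rightarrow> ereal" where
  "f_divergence f P Q =
     f_divergence_densities f P Q
       (\<lambda>x. enn2real (RN_deriv (sum_measure P Q) P x))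
       (\<lambda>x. enn2real (RN_deriv (sum_measure P Q) Q x))"

text \<open>
  All pairs of probability measures on a common measurable space whose points lie in \<open>'a\<close>.  The
  underlying set and the sigma-algebra are arbitrary, so an infinite \<open>'a\<close> serves as a universe of
  measurable spaces; ``all possible measurable spaces'' is rendered by leaving \<open>'a\<close> arbitrary.
\<close>

definition prob_pairs :: "('a measure \<times> 'a measure) set" where
  "prob_pairs = {(P, Q). prob_space P \<and> prob_space Q \<and> sets P = sets Q}"

definition prob_measures_upto :: "nat \<Rightarrow> nat measure set" where
  "prob_measures_upto n = {P. prob_space P \<and> sets P = Pow {1..n}}"

definition divergence_finite_on ::
    "('a measure \<times> 'a measure) set \<Rightarrow> (real \<Rightarrow> real) \<Rightarrow> bool" where
  "divergence_finite_on K f \<longleftrightarrow> (SUP (P, Q)\<in>K. f_divergence f P Q) < \<infinity>"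

text \<open>
  Supremum and infimum are taken in \<open>ereal\<close>; in particular the infimum over an infeasible set of
  constraints is \<open>\<infinity>\<close>.
\<close>

definition constrained_sup ::
    "('a measure \<times> 'a measure) set \<Rightarrow> (real \<Rightarrow> real) \<Rightarrow> nat \<Rightarrow> (nat \<Rightarrow> real \<Rightarrow> real) \<Rightarrow> (nat \<Rightarrow> real) \<Rightarrow> ereal"
  where
  "constrained_sup K f m fs D =
     Sup {f_divergence f P Q | P Q. (P, Q) \<in> K \<and>
            (\<forall>i\<in>{1..m}. f_divergence (fs i) P Q \<le> ereal (D i))}"

definition constrained_inf ::
    "('a measure \<times> 'a measure) set \<Rightarrow> (real \<Rightarrow> real) \<Rightarrow> nat \<Rightarrow> (nat \<Rightarrow> real \<Rightarrow> real) \<Rightarrow> (nat \<Rightarrow> real) \<Rightarrow> ereal"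
  where
  "constrained_inf K f m fs D =
     Inf {f_divergence f P Q | P Q. (P, Q) \<in> K \<and>
            (\<forall>i\<in>{1..m}. f_divergence (fs i) P Q \<ge> ereal (D i))}"

definition A_n :: "nat \<Rightarrow> (real \<Rightarrow> real) \<Rightarrow> nat \<Rightarrow> (nat \<Rightarrow> real \<Rightarrow> real) \<Rightarrow> (nat \<Rightarrow> real) \<Rightarrow> ereal" where
  "A_n n = constrained_sup (prob_measures_upto n \<times> prob_measures_upto n)"

definition B_n :: "nat \<Rightarrow> (real \<Rightarrow> real) \<Rightarrow> nat \<Rightarrow> (nat \<Rightarrow> real \<Rightarrow> real) \<Rightarrow> (nat \<Rightarrow> real) \<Rightarrow> ereal" where
  "B_n n = constrained_inf (prob_measures_upto n \<times> prob_measures_upto n)"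

lemma sets_sum_measure [simp]: "sets (sum_measure P Q) = sets P"
  and space_sum_measure [simp]: "space (sum_measure P Q) = space P"
  by (simp_all add: sum_measure_def)

lemma emeasure_sum_measure:
  assumes "sets P = sets Q" "A \<in> sets P"
  shows "emeasure (sum_measure P Q) A = emeasure P A + emeasure Q A"
proof (rule emeasure_measure_of[OF sum_measure_def])
  show "sets P \<subseteq> Pow (space P)" by (rule sets.space_closed)
  show "A \<in> sets (sum_measure P Q)" using assms by simp
  show "positive (sets (sum_measure P Q)) (\<lambda>A. emeasure P A + emeasure Q A)"
    by (simp add: positive_def)
  show "countably_additive (sets (sum_measure P Q)) (\<lambda>A. emeasure P A + emeasure Q A)"
  proof (rule countably_additiveI)
    fix A :: "nat \<Rightarrow> 'a set"
    assume A: "range A \<subseteq> sets (sum_measure P Q)" "disjoint_family A"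
    show "(\<Sum>i. emeasure P (A i) + emeasure Q (A i)) = emeasure P (\<Union>i. A i) + emeasure Q (\<Union>i. A i)"
      using A assms(1) by (simp add: suminf_add[symmetric] suminf_emeasure)
  qed
qed

theorem f_divergence_eq:
  assumes L: "sigma_finite_measure L"
    and p [measurable]: "p \<in> borel_measurable L" and p0: "\<And>x. 0 \<le> p x"
    and q [measurable]: "q \<in> borel_measurable L" and q0: "\<And>x. 0 \<le> q x"
    and P: "P = density L (\<lambda>x. ennreal (p x))" and Q: "Q = density L (\<lambda>x. ennreal (q x))"
    and "prob_space P" "prob_space Q"
  shows "f_divergence f P Q = f_divergence_densities f P Q p q"
proof -
  interpret L: sigma_finite_measure L by fact
  interpret P: prob_space P by fact
  interpret Q: prob_space Q by fact
  define M where "M = sum_measure P Q"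
  define a where "a = RN_deriv M P"
  define b where "b = RN_deriv M Q"
  have sP [measurable_cong]: "sets P = sets L" and sQ [measurable_cong]: "sets Q = sets L"
    and sM [measurable_cong]: "sets M = sets L"
    by (simp_all add: P Q M_def)
  have spL: "space P = space L" by (simp add: P)
  have emM: "emeasure M A = emeasure P A + emeasure Q A" if "A \<in> sets L" for A
    unfolding M_def by (rule emeasure_sum_measure) (use that sP sQ in auto)
  have M: "M = density L (\<lambda>x. ennreal (p x + q x))"
  proof (rule measure_eqI)
    show "sets M = sets (density L (\<lambda>x. ennreal (p x + q x)))" by (simp add: sM)
    fix A assume "A \<in> sets M"
    then have A [measurable]: "A \<in> sets L" by (simp add: sM)
    show "emeasure M A = emeasure (density L (\<lambda>x. ennreal (p x + q x))) A"
      using p0 q0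
      by (simp add: emM) (simp add: P Q emeasure_density ennreal_plus distrib_right nn_integral_add)
  qed
  have "finite_measure M"
    by (rule finite_measureI)
       (simp add: emM sets_eq_imp_space_eq[OF sM] P.emeasure_eq_measure Q.emeasure_eq_measure)
  then interpret M: finite_measure M .
  have [measurable]: "a \<in> borel_measurable L" "b \<in> borel_measurable L"
    using borel_measurable_RN_deriv[of M P] borel_measurable_RN_deriv[of M Q]
    by (simp_all add: a_def b_def measurable_cong_sets[OF sM refl])
  have "absolutely_continuous M P" "absolutely_continuous M Q"
    by (auto simp: absolutely_continuous_def null_sets_def emM sM sP sQ)
  then have dP: "density M a = P" and dQ: "density M b = Q"
    unfolding a_def b_def by (auto intro!: M.density_RN_deriv simp: sP sQ sM)
  have "density L (\<lambda>x. ennreal (p x + q x) * a x) = density L (\<lambda>x. ennreal (p x))"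
    using dP by (simp add: M density_density_eq flip: P)
  then have A: "AE x in L. ennreal (p x + q x) * a x = ennreal (p x)"
    by (subst (asm) L.density_unique_iff) auto
  have "density L (\<lambda>x. ennreal (p x + q x) * b x) = density L (\<lambda>x. ennreal (q x))"
    using dQ by (simp add: M density_density_eq flip: Q)
  then have B: "AE x in L. ennreal (p x + q x) * b x = ennreal (q x)"
    by (subst (asm) L.density_unique_iff) auto
  have real_eq: "s * enn2real c = r" if "ennreal s * c = ennreal r" "0 \<le> r" "0 \<le> s" for s r c
    using that by (metis enn2real_mult enn2real_ennreal)
  have AB: "AE x in L. (p x + q x) * enn2real (a x) = p x \<and> (p x + q x) * enn2real (b x) = q x"
    using A B by eventually_elim (auto intro!: real_eq simp: p0 q0)
  have 1: "AE x in Q. (if 0 < enn2real (b x)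
        then extend_to_0 f (enn2real (a x) / enn2real (b x)) else 0) =
      (if 0 < q x then extend_to_0 f (p x / q x) else 0)"
    unfolding Q
  proof (subst AE_density, simp, use AB in eventually_elim, rule impI)
    fix x assume *: "(p x + q x) * enn2real (a x) = p x \<and> (p x + q x) * enn2real (b x) = q x"
      and "0 < ennreal (q x)"
    then have qx: "0 < q x" by simp
    then have s: "0 < p x + q x" using p0[of x] by simp
    have "0 < enn2real (b x)"
      using * qx s by (metis enn2real_nonneg less_eq_real_def mult_zero_right)
    moreover have "enn2real (a x) / enn2real (b x) = p x / q x"
      using * s by (metis less_numeral_extra(3) mult_divide_mult_cancel_left)
    ultimately show "(if 0 < enn2real (b x)
        then extend_to_0 f (enn2real (a x) / enn2real (b x)) else 0) =
      (if 0 < q x then extend_to_0 f (p x / q x) else 0)"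
      using qx by simp
  qed
  have 2: "AE x in P. enn2real (b x) = 0 \<longleftrightarrow> q x = 0"
    unfolding P
  proof (subst AE_density, simp, use AB in eventually_elim, rule impI)
    fix x assume *: "(p x + q x) * enn2real (a x) = p x \<and> (p x + q x) * enn2real (b x) = q x"
      and "0 < ennreal (p x)"
    then have "0 < p x + q x" using q0[of x] by (simp add: add_pos_nonneg)
    then show "enn2real (b x) = 0 \<longleftrightarrow> q x = 0"
      using * by (metis less_irrefl mult_eq_0_iff)
  qed
  have "measure P {x \<in> space P. enn2real (b x) = 0} = measure P {x \<in> space P. q x = 0}"
    by (rule P.finite_measure_eq_AE) (use 2 in \<open>auto elim!: eventually_mono\<close>)
  moreover have "ereal_integral Q (\<lambda>x. if 0 < enn2real (b x)
        then extend_to_0 f (enn2real (a x) / enn2real (b x)) else 0) =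
      ereal_integral Q (\<lambda>x. if 0 < q x then extend_to_0 f (p x / q x) else 0)"
    unfolding ereal_integral_def
    by (intro arg_cong2[where f = minus] arg_cong[where f = enn2ereal] nn_integral_cong_AE;
        use 1 in eventually_elim; simp)
  ultimately show ?thesis
    by (simp add: f_divergence_def f_divergence_densities_def flip: M_def a_def b_def)
qed

end

theory Submission
  imports Defs
begin

text \<open>
  Write \<open>\<phi>\<close> for the perspective \<open>(p, q) \<mapsto> q f(p / q)\<close>, extended by \<open>p f'(\<infinity>)\<close> to \<open>q = 0\<close>; it is
  positively homogeneous, and the divergence is the integral of \<open>\<phi>(p, q)\<close> over a dominating measure.
  If the \<open>m + 2\<close> functions \<open>p\<close>, \<open>q\<close>, \<open>\<phi>\<^sub>1(p, q), \<dots>, \<phi>\<^sub>m(p, q)\<close> are integrable, their vector of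
  integrals is a nonnegative combination of their values at finitely many points, and the weights are
  absorbed into \<open>(p, q)\<close> by homogeneity.  With more than \<open>m + 2\<close> points there is a linear dependence
  along which the weights can be moved, without decreasing a prescribed objective, until one of them
  vanishes.  Infinite values are handled by replacing the objective (for the supremum) or the
  constraint functions (for the infimum) by integrable minorants.
\<close>

section \<open>Finitely supported representation of integrals\<close>

text \<open>The obstacle is exactness. It is easy to see that the vector of integrals lies in the
  closed cone generated by the values, but that cone need not be closed without its closure, and an
  approximate combination would break the normalisation of the two measures or a constraint.
  Equality is therefore reached inside the cone itself, by an induction on coordinates that keeps
  all points in the cone. The number \<open>m + 2\<close> counts two coordinates for
  \<open>p\<close> and \<open>q\<close> and one for each constraint. The objective gets no lasting
  coordinate, since it only has to move in the right direction. Strict positivity of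
  \<open>p + q\<close> is what forces a weight to vanish when weights are moved along a dependence.
  The two problems differ in what may be infinite. For the supremum, feasibility makes the
  constraint divergences finite and the objective may be infinite. For the infimum, an infinite
  objective leaves nothing to prove, while the constraints may be infinite. A minorant suffices in
  both cases because it bounds the quantity from below at every atom, the side on which the
  inequality is wanted.\<close>

text \<open>Fewer homogeneous equations than unknowns, solved by Gaussian elimination: a pivot
  \<open>t\<close> with \<open>g k t \<noteq> 0\<close> expresses the unknown at \<open>t\<close>
  through the others.\<close>

lemma exists_nontrivial_dependence:
  fixes g :: "nat \<Rightarrow> 's \<Rightarrow> real"
  assumes "finite S" "k < card S"
  shows "\<exists>v. (\<exists>s\<in>S. v s \<noteq> 0) \<and> (\<forall>i<k. (\<Sum>s\<in>S. v s * g i s) = 0)"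
  using assms
proof (induction k arbitrary: S g)
  case 0
  then show ?case by (intro exI[of _ "\<lambda>_. 1"]) (auto simp: card_gt_0_iff)
next
  case (Suc k)
  show ?case
  proof (cases "\<forall>s\<in>S. g k s = 0")
    case True
    obtain v where "\<exists>s\<in>S. v s \<noteq> 0" "\<forall>i<k. (\<Sum>s\<in>S. v s * g i s) = 0"
      using Suc.IH[of S g] Suc.prems by auto
    with True show ?thesis by (auto simp: less_Suc_eq intro!: exI[of _ v])
  next
    case False
    then obtain t where t: "t \<in> S" "g k t \<noteq> 0" by auto
    define S' where "S' = S - {t}"
    have S': "finite S'" "k < card S'" "S = insert t S'" "t \<notin> S'"
      using Suc.prems t by (auto simp: S'_def)
    \<comment> \<open>Each remaining equation is reduced by the multiple of equation
      \<open>k\<close> that removes the unknown at \<open>t\<close>; \<open>u\<close> then restores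
      that unknown so that equation \<open>k\<close> holds.\<close>
    obtain v where v: "\<exists>s\<in>S'. v s \<noteq> 0"
      and v0: "\<And>i. i < k \<Longrightarrow> (\<Sum>s\<in>S'. v s * (g i s - g i t * g k s / g k t)) = 0"
      using Suc.IH[OF S'(1,2), of "\<lambda>i s. g i s - g i t * g k s / g k t"] by blast
    define u where "u = (\<lambda>s. if s = t then - (\<Sum>s\<in>S'. v s * g k s) / g k t else v s)"
    have u: "(\<Sum>s\<in>S. u s * g i s)
        = - (\<Sum>s\<in>S'. v s * g k s) / g k t * g i t + (\<Sum>s\<in>S'. v s * g i s)" for i
    proof -
      have "(\<Sum>s\<in>S'. u s * g i s) = (\<Sum>s\<in>S'. v s * g i s)"
        using S'(4) by (intro sum.cong) (auto simp: u_def)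
      then show ?thesis using S' by (simp add: u_def)
    qed
    have "(\<Sum>s\<in>S. u s * g i s) = 0" if "i < Suc k" for i
    proof (cases "i = k")
      case True
      then show ?thesis using t by (simp add: u)
    next
      case False
      then have "i < k" using that by simp
      from v0[OF this] show ?thesis
        by (simp add: u sum_distrib_left sum_distrib_right sum_subtractf sum_negf
            sum_divide_distrib algebra_simps)
    qed
    moreover have "\<exists>s\<in>S. u s \<noteq> 0" using v S' by (auto simp: u_def)
    ultimately show ?thesis by blast
  qed
qed

text \<open>Caratheodory's argument for cones. As \<open>h 0\<close> is positive on
  \<open>S\<close>, a dependence cannot be one-signed, so moving the weights along it makes one of
  them vanish after a finite distance while the \<open>k\<close> sums stay fixed.\<close>

lemma reduce_support:
  fixes h :: "nat \<Rightarrow> 's \<Rightarrow> real" and G w :: "'s \<Rightarrow> real"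
  assumes "finite S" "\<And>s. s \<in> S \<Longrightarrow> 0 \<le> w s" "0 < k" "\<And>s. s \<in> S \<Longrightarrow> 0 < h 0 s"
  shows "\<exists>T u. T \<subseteq> S \<and> card T \<le> k \<and> (\<forall>s\<in>T. 0 \<le> u s) \<and>
    (\<forall>i<k. (\<Sum>s\<in>T. u s * h i s) = (\<Sum>s\<in>S. w s * h i s)) \<and>
    (\<Sum>s\<in>S. w s * G s) \<le> (\<Sum>s\<in>T. u s * G s)"
  using assms
proof (induction "card S" arbitrary: S w rule: less_induct)
  case less
  show ?case
  proof (cases "card S \<le> k")
    case True
    then show ?thesis using less.prems by blast
  next
    case False
    then obtain v0 where v0: "\<exists>s\<in>S. v0 s \<noteq> 0" "\<And>i. i < k \<Longrightarrow> (\<Sum>s\<in>S. v0 s * h i s) = 0"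
      using exists_nontrivial_dependence[of S k h] less.prems by auto
    \<comment> \<open>The sign of a dependence is free; this choice makes the objective
      nondecreasing along \<open>v\<close>, so \<open>G\<close> uses up no equation.\<close>
    define v where "v = (\<lambda>s. (if 0 \<le> (\<Sum>s\<in>S. v0 s * G s) then 1 else - 1) * v0 s)"
    have v: "\<exists>s\<in>S. v s \<noteq> 0" "\<And>i. i < k \<Longrightarrow> (\<Sum>s\<in>S. v s * h i s) = 0"
        "0 \<le> (\<Sum>s\<in>S. v s * G s)"
      using v0 by (auto simp: v_def sum_negf)
    have "\<exists>s\<in>S. v s < 0"
    proof (rule ccontr)
      assume "\<not> ?thesis"
      then have nn: "\<And>s. s \<in> S \<Longrightarrow> 0 \<le> v s" by force
      have "\<forall>s\<in>S. v s * h 0 s = 0"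
        using v(2)[OF \<open>0 < k\<close>] less.prems(1) mult_nonneg_nonneg[OF nn less_imp_le[OF less.prems(4)]]
        by (subst (asm) sum_nonneg_eq_0_iff) auto
      then show False using v(1) less.prems(4) by force
    qed
    then have ne: "{s\<in>S. v s < 0} \<noteq> {}" by auto
    \<comment> \<open>The longest step that keeps all weights nonnegative; the index attaining the
      minimum loses its weight.\<close>
    define \<theta> where "\<theta> = Min ((\<lambda>s. w s / - v s) ` {s\<in>S. v s < 0})"
    have "\<theta> \<in> (\<lambda>s. w s / - v s) ` {s\<in>S. v s < 0}"
      unfolding \<theta>_def using ne less.prems by (intro Min_in) auto
    then obtain t where t: "t \<in> S" "v t < 0" "\<theta> = w t / - v t" by auto
    have th: "0 \<le> \<theta>" unfolding t(3) using t less.prems by (intro divide_nonneg_pos) auto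
    define u where "u = (\<lambda>s. w s + \<theta> * v s)"
    have u0: "u t = 0" using t by (simp add: u_def)
    have un: "0 \<le> u s" if "s \<in> S" for s
    proof (cases "v s < 0")
      case True
      then have "\<theta> \<le> w s / - v s"
        unfolding \<theta>_def using that less.prems by (intro Min_le) auto
      then have "\<theta> * - v s \<le> w s" using True by (subst (asm) pos_le_divide_eq) auto
      then show ?thesis by (simp add: u_def)
    next
      case False
      then show ?thesis using th that less.prems by (auto simp: u_def intro!: add_nonneg_nonneg)
    qed
    have us: "(\<Sum>s\<in>S-{t}. u s * a s) = (\<Sum>s\<in>S. w s * a s) + \<theta> * (\<Sum>s\<in>S. v s * a s)" for a
    proof -
      have "(\<Sum>s\<in>S-{t}. u s * a s) = (\<Sum>s\<in>S. u s * a s)"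
        using t u0 less.prems by (simp add: sum.remove[of S t])
      then show ?thesis by (simp add: u_def sum.distrib sum_distrib_left algebra_simps)
    qed
    have "card (S - {t}) < card S" using t less.prems by (intro card_Diff1_less)
    from less.hyps[OF this, of u] less.prems un
    obtain T x where T: "T \<subseteq> S - {t}" "card T \<le> k" "\<forall>s\<in>T. 0 \<le> x s"
      "\<forall>i<k. (\<Sum>s\<in>T. x s * h i s) = (\<Sum>s\<in>S-{t}. u s * h i s)"
      "(\<Sum>s\<in>S-{t}. u s * G s) \<le> (\<Sum>s\<in>T. x s * G s)"
      by auto
    have "0 \<le> \<theta> * (\<Sum>s\<in>S. v s * G s)" using th v(3) by simp
    with T show ?thesis
      by (intro exI[of _ T] exI[of _ x]) (auto simp: us v(2))
  qed
qed

section \<open>Zero-mean vectors and exact finite combinations\<close>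

lemma integral_pair_mult:
  fixes f :: "'a \<Rightarrow> real" and g :: "'b \<Rightarrow> real"
  assumes "finite_measure M" "finite_measure N" "integrable M f" "integrable N g"
  shows "integrable (M \<Otimes>\<^sub>M N) (\<lambda>z. f (fst z) * g (snd z))"
    and "(\<integral>z. f (fst z) * g (snd z) \<partial>(M \<Otimes>\<^sub>M N)) = integral\<^sup>L M f * integral\<^sup>L N g"
proof -
  interpret M: finite_measure M by fact
  interpret N: finite_measure N by fact
  interpret pair_sigma_finite M N ..
  note [measurable] = borel_measurable_integrable[OF assms(3)] borel_measurable_integrable[OF assms(4)]
  show 1: "integrable (M \<Otimes>\<^sub>M N) (\<lambda>z. f (fst z) * g (snd z))"
  proof (rule Fubini_integrable)
    show "(\<lambda>z. f (fst z) * g (snd z)) \<in> borel_measurable (M \<Otimes>\<^sub>M N)" by measurable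
    show "integrable M (\<lambda>x. \<integral>y. norm (f (fst (x, y)) * g (snd (x, y))) \<partial>N)"
      using assms by (simp add: abs_mult)
    show "AE x in M. integrable N (\<lambda>y. f (fst (x, y)) * g (snd (x, y)))"
      using assms by simp
  qed
  show "(\<integral>z. f (fst z) * g (snd z) \<partial>(M \<Otimes>\<^sub>M N)) = integral\<^sup>L M f * integral\<^sup>L N g"
    by (subst integral_fst'[symmetric, OF 1]) simp
qed

lemma emeasure_space_distr:
  assumes "f \<in> measurable M N"
  shows "emeasure (distr M N f) (space (distr M N f)) = emeasure M (space M)"
proof -
  have "f -` space N \<inter> space M = space M" using measurable_space[OF assms] by auto
  then show ?thesis using assms by (simp add: emeasure_distr)
qed

text \<open>
  Fourier-Motzkin elimination for measures: to remove coordinate \<open>k\<close>, combine every point \<open>x\<close> with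
  \<open>x k \<ge> 0\<close> and every point \<open>y\<close> with \<open>y k < 0\<close> to \<open>- y k * x + x k * y\<close>, under the product measure.
  The other means are only multiplied by the mean of the positive part of coordinate \<open>k\<close>.
\<close>

lemma zero_mean_in_cone:
  fixes M :: "(nat \<Rightarrow> real) measure" and C :: "(nat \<Rightarrow> real) set"
  assumes "finite_measure M" "emeasure M (space M) \<noteq> 0" "space M \<subseteq> C"
    and "\<And>i. (\<lambda>v. v i) \<in> borel_measurable M"
    and "\<And>i. i < k \<Longrightarrow> integrable M (\<lambda>v. v i)" "\<And>i. i < k \<Longrightarrow> (\<integral>v. v i \<partial>M) = 0"
    and "\<And>u v. u \<in> C \<Longrightarrow> v \<in> C \<Longrightarrow> (\<lambda>i. u i + v i) \<in> C"
    and "\<And>a v. 0 < a \<Longrightarrow> v \<in> C \<Longrightarrow> (\<lambda>i. a * v i) \<in> C"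
  shows "\<exists>v\<in>C. \<forall>i<k. v i = 0"
  using assms
proof (induction k arbitrary: M C)
  case 0
  then have "space M \<noteq> {}" by auto
  with "0.prems" show ?case by blast
next
  case (Suc k)
  interpret M: finite_measure M by fact
  note meas [measurable] = Suc.prems(4)
  note int = Suc.prems(5) and int0 = Suc.prems(6) and add = Suc.prems(7) and scale = Suc.prems(8)
  \<comment> \<open>Again closed under sums and positive multiples, so it can take the place of
    \<open>C\<close> in the induction hypothesis.\<close>
  define C' where "C' = {v\<in>C. v k = 0}"
  have C'_add: "(\<lambda>i. u i + v i) \<in> C'" if "u \<in> C'" "v \<in> C'" for u v
    using that add by (auto simp: C'_def)
  have C'_scale: "(\<lambda>i. a * v i) \<in> C'" if "0 < a" "v \<in> C'" for a v
    using that scale by (auto simp: C'_def)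
  have intk: "integrable M (\<lambda>v. v k)" "(\<integral>v. v k \<partial>M) = 0" using int int0 by auto
  have "\<exists>v\<in>C'. \<forall>i<k. v i = 0"
  \<comment> \<open>The degenerate case is separate because the part with \<open>v k < 0\<close> is
    then null and the product measure would have mass 0.\<close>
  proof (cases "AE v in M. v k = 0")
    case True
    define Z where "Z = {v\<in>space M. v k = 0}"
    have Z [measurable]: "Z \<in> sets M" by (simp add: Z_def)
    have AEZ: "AE v in M. v \<in> Z" using True by (auto simp: Z_def)
    have sub: "Z \<subseteq> space M" by (auto simp: Z_def)
    show ?thesis
    proof (rule Suc.IH[of "restrict_space M Z"])
      show "finite_measure (restrict_space M Z)"
        by (intro finite_measure_restrict_space Suc.prems Z)
      have "emeasure M Z = emeasure M (space M)"
        using AEZ by (intro emeasure_eq_AE) auto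
      then show "emeasure (restrict_space M Z) (space (restrict_space M Z)) \<noteq> 0"
        using Suc.prems sub by (simp add: space_restrict_space emeasure_restrict_space Int_absorb2)
      show "space (restrict_space M Z) \<subseteq> C'"
        using Suc.prems(3) by (auto simp: space_restrict_space Z_def C'_def)
      show "(\<lambda>v. v i) \<in> borel_measurable (restrict_space M Z)" for i
        by (intro measurable_restrict_space1 meas)
      fix i assume i: "i < k"
      have ae: "AE v in M. indicat_real Z v *\<^sub>R v i = v i" using AEZ by eventually_elim auto
      have "integrable M (\<lambda>v. indicat_real Z v *\<^sub>R v i)"
        using int[of i] i integrable_cong_AE[OF _ _ ae] by simp
      then show "integrable (restrict_space M Z) (\<lambda>v. v i)"
        by (subst integrable_restrict_space) auto
      show "(\<integral>v. v i \<partial>restrict_space M Z) = 0"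
        using int0[of i] i integral_cong_AE[OF _ _ ae] by (subst integral_restrict_space) auto
    qed (use C'_add C'_scale in auto)
  next
    case False
    define P N where "P = {v\<in>space M. 0 \<le> v k}" and "N = {v\<in>space M. v k < 0}"
    have PN [measurable]: "P \<in> sets M" "N \<in> sets M" by (simp_all add: P_def N_def)
    have sub: "P \<subseteq> space M" "N \<subseteq> space M" by (auto simp: P_def N_def)
    define MP MN where "MP = restrict_space M P" and "MN = restrict_space M N"
    have fin: "finite_measure MP" "finite_measure MN"
      unfolding MP_def MN_def by (intro finite_measure_restrict_space Suc.prems PN)+
    interpret MP: finite_measure MP by fact
    interpret MN: finite_measure MN by fact
    have sp: "space MP = P" "space MN = N"
      using sub by (auto simp: MP_def MN_def space_restrict_space)
    have mPN [measurable]: "(\<lambda>v. v i) \<in> borel_measurable MP" "(\<lambda>v. v i) \<in> borel_measurable MN" for i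
      unfolding MP_def MN_def by (intro measurable_restrict_space1 meas)+
    have iP: "integrable MP (\<lambda>v. v i)" and iN: "integrable MN (\<lambda>v. v i)"
      and split: "(\<integral>v. v i \<partial>MP) + (\<integral>v. v i \<partial>MN) = 0" if "i \<le> k" for i
    proof -
      have 0: "integrable M (\<lambda>v. v i)" using int that by simp
      have 1: "integrable M (\<lambda>v. indicat_real P v *\<^sub>R v i)" "integrable M (\<lambda>v. indicat_real N v *\<^sub>R v i)"
        by (intro integrable_mult_indicator PN 0)+
      then show "integrable MP (\<lambda>v. v i)" "integrable MN (\<lambda>v. v i)"
        unfolding MP_def MN_def by (auto simp: integrable_restrict_space)
      have "(\<integral>v. v i \<partial>MP) + (\<integral>v. v i \<partial>MN)
          = (\<integral>v. indicat_real P v *\<^sub>R v i + indicat_real N v *\<^sub>R v i \<partial>M)"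
        unfolding MP_def MN_def using 1 by (subst Bochner_Integration.integral_add)
          (auto simp: integral_restrict_space)
      also have "\<dots> = (\<integral>v. v i \<partial>M)"
        by (intro Bochner_Integration.integral_cong) (auto simp: P_def N_def indicator_def)
      finally show "(\<integral>v. v i \<partial>MP) + (\<integral>v. v i \<partial>MN) = 0" using int0 that by simp
    qed
    define c where "c = (\<integral>v. v k \<partial>MP)"
    have cN: "(\<integral>v. v k \<partial>MN) = - c" using split[of k] by (simp add: c_def)
    \<comment> \<open>If \<open>c = 0\<close>, both halves carry a one-signed coordinate of mean 0,
      so the coordinate vanishes almost everywhere. Nonzero \<open>c\<close> in turn gives both
      halves positive mass.\<close>
    have c_ne: "c \<noteq> 0"
    proof
      assume c: "c = 0"
      have "AE v in MP. 0 \<le> v k" by (intro AE_I2) (simp add: sp P_def)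
      then have "AE v in MP. v k = 0"
        using c iP[of k] integral_nonneg_eq_0_iff_AE[of MP "\<lambda>v. v k"] by (simp add: c_def)
      moreover have "AE v in MN. 0 \<le> - v k" by (intro AE_I2) (simp add: sp N_def)
      then have "AE v in MN. - v k = 0"
        using c cN iN[of k] integral_nonneg_eq_0_iff_AE[of MN "\<lambda>v. - v k"] by simp
      ultimately have "AE v in M. v \<in> P \<longrightarrow> v k = 0" "AE v in M. v \<in> N \<longrightarrow> - v k = 0"
        using sub unfolding MP_def MN_def by (simp_all add: AE_restrict_space_iff Int_absorb2)
      with AE_space have "AE v in M. v k = 0"
        by eventually_elim (auto simp: P_def N_def not_le)
      with False show False ..
    qed
    have pos: "emeasure MP (space MP) \<noteq> 0" "emeasure MN (space MN) \<noteq> 0"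
    proof -
      have *: "integral\<^sup>L K g = 0" if "emeasure K (space K) = 0" for K and g :: "(nat \<Rightarrow> real) \<Rightarrow> real"
      proof -
        have "AE v in K. g v = 0" using that by (intro AE_I[of _ _ "space K"]) auto
        then show ?thesis by (rule integral_eq_zero_AE)
      qed
      show "emeasure MP (space MP) \<noteq> 0" "emeasure MN (space MN) \<noteq> 0"
        using *[of MP "\<lambda>v. v k"] *[of MN "\<lambda>v. v k"] c_ne cN c_def by auto
    qed
    define F :: "(nat \<Rightarrow> real) \<times> (nat \<Rightarrow> real) \<Rightarrow> nat \<Rightarrow> real"
      where "F = (\<lambda>z i. - snd z k * fst z i + fst z k * snd z i)"
    have FC: "F z \<in> C'" if zPN: "z \<in> space (MP \<Otimes>\<^sub>M MN)" for z
    proof -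
      obtain x y where z: "z = (x, y)" "x \<in> P" "y \<in> N"
        using zPN unfolding space_pair_measure sp by blast
      then have xy: "x \<in> C" "y \<in> C" "0 \<le> x k" "y k < 0"
        using Suc.prems(3) by (auto simp: P_def N_def)
      have 1: "(\<lambda>i. - y k * x i) \<in> C" using xy by (intro scale) auto
      have "F z \<in> C"
      \<comment> \<open>\<open>C\<close> is closed only under strictly positive multiples and need
        not contain 0, so a summand with factor 0 is dropped instead of scaled.\<close>
      proof (cases "x k = 0")
        case True
        then show ?thesis using 1 by (simp add: F_def z)
      next
        case False
        then have "(\<lambda>i. x k * y i) \<in> C" using xy by (intro scale) auto
        then show ?thesis using add[OF 1] by (simp add: F_def z)
      qed
      then show ?thesis by (simp add: C'_def F_def)
    qed
    \<comment> \<open>The target carries the trace of the Borel sets on \<open>C'\<close>, so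
      \<open>space M' \<subseteq> C'\<close> holds by construction although \<open>C'\<close> need
      not be Borel.\<close>
    define M' where "M' = distr (MP \<Otimes>\<^sub>M MN) (restrict_space borel C') F"
    have F [measurable]: "F \<in> measurable (MP \<Otimes>\<^sub>M MN) (restrict_space borel C')"
    proof (rule measurable_restrict_space2)
      show "F \<in> borel_measurable (MP \<Otimes>\<^sub>M MN)"
        by (rule measurable_coordinatewise_then_product) (simp add: F_def)
    qed (use FC in auto)
    have co [measurable]: "(\<lambda>v. v i) \<in> borel_measurable (restrict_space borel C')" for i :: nat
      by (intro measurable_restrict_space1 borel_measurable_continuous_onI) simp
    show ?thesis
    proof (rule Suc.IH[of M'])
      have fp: "finite_measure (MP \<Otimes>\<^sub>M MN)"
        by (rule finite_measure_pair_measure) fact+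
      show "finite_measure M'"
        unfolding M'_def using fp F by (rule finite_measure.finite_measure_distr)
      have "emeasure M' (space M') = emeasure MP (space MP) * emeasure MN (space MN)"
        unfolding M'_def
        using emeasure_space_distr[OF F]
        by (simp add: space_pair_measure MN.emeasure_pair_measure_Times)
      then show "emeasure M' (space M') \<noteq> 0" using pos by simp
      show "space M' \<subseteq> C'" by (simp add: M'_def space_restrict_space)
      show "(\<lambda>v. v i) \<in> borel_measurable M'" for i by (simp add: M'_def)
      fix i assume i: "i < k"
      have ii: "i \<le> k" "k \<le> k" using i by auto
      note A = integral_pair_mult[OF fin iP[OF ii(1)] integrable_minus[OF iN[OF ii(2)]]]
      note B = integral_pair_mult[OF fin iP[OF ii(2)] iN[OF ii(1)]]
      have Fi: "(\<lambda>z. F z i) = (\<lambda>z. fst z i * - snd z k + fst z k * snd z i)"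
        by (auto simp: F_def)
      show "integrable M' (\<lambda>v. v i)"
        unfolding M'_def using A(1) B(1)
        by (subst integrable_distr_eq) (simp_all only: F co Fi Bochner_Integration.integrable_add)
      have "(\<integral>v. v i \<partial>M') = (\<integral>z. fst z i * - snd z k + fst z k * snd z i \<partial>(MP \<Otimes>\<^sub>M MN))"
        unfolding M'_def by (subst integral_distr) (simp_all only: F co Fi)
      \<comment> \<open>The products factorise under the product measure, and
        \<open>- snd z k\<close> also has mean \<open>c\<close>; what remains is \<open>c\<close>
        times the original mean.\<close>
      also have "\<dots> = (\<integral>v. v i \<partial>MP) * c + c * (\<integral>v. v i \<partial>MN)"
        using A B cN by (simp only: Bochner_Integration.integral_add) (simp add: c_def)
      also have "\<dots> = c * ((\<integral>v. v i \<partial>MP) + (\<integral>v. v i \<partial>MN))" by (simp add: algebra_simps)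
      finally show "(\<integral>v. v i \<partial>M') = 0" using split[OF ii(1)] by simp
    qed (use C'_add C'_scale in auto)
  qed
  then show ?case by (auto simp: C'_def less_Suc_eq)
qed

text \<open>\<open>G\<close> first travels as an additional coordinate, which yields a finite
  combination exact for all the integrals; \<open>reduce_support\<close> then cuts it to
  \<open>k\<close> points at the price of an inequality for \<open>G\<close>. Zero means are
  obtained by comparing each function with the positive function \<open>h 0\<close>.\<close>

lemma finite_representation:
  fixes L :: "'x measure" and h :: "nat \<Rightarrow> 'x \<Rightarrow> real" and G :: "'x \<Rightarrow> real"
  assumes "finite_measure L" "emeasure L (space L) \<noteq> 0" "0 < k"
    and "\<And>i. i < k \<Longrightarrow> integrable L (h i)" "integrable L G"
    and \<Omega> [measurable]: "\<Omega> \<in> sets L" and AE\<Omega>: "AE x in L. x \<in> \<Omega>"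
    and pos: "\<And>x. x \<in> \<Omega> \<Longrightarrow> 0 < h 0 x"
  shows "\<exists>s w. (\<forall>j\<in>{1..k}. s j \<in> \<Omega> \<and> 0 \<le> w j) \<and>
    (\<forall>i<k. (\<Sum>j=1..k. w j * h i (s j)) = integral\<^sup>L L (h i)) \<and>
    integral\<^sup>L L G \<le> (\<Sum>j=1..k. w j * G (s j))"
proof -
  interpret L: finite_measure L by fact
  define g where "g = (\<lambda>i. if i < k then h i else G)"
  define H where "H = (\<lambda>i. integral\<^sup>L L (g i))"
  have g [simp]: "integrable L (g i)" for i using assms by (auto simp: g_def)
  have [measurable]: "g i \<in> borel_measurable L" for i by (rule borel_measurable_integrable) simp
  have g0: "g 0 = h 0" using assms by (simp add: g_def)
  have AEpos: "AE x in L. 0 < g 0 x" using AE\<Omega> by eventually_elim (auto simp: g0 pos)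
  have "H 0 \<noteq> 0"
  proof
    assume "H 0 = 0"
    then have "AE x in L. g 0 x = 0"
      using AEpos unfolding H_def by (subst (asm) integral_nonneg_eq_0_iff_AE) auto
    with AEpos have "AE x in L. False" by eventually_elim simp
    then show False using assms(2) by (simp add: AE_iff_measurable[OF sets.top])
  qed
  moreover have "0 \<le> H 0" unfolding H_def by (intro integral_nonneg_AE) (use AEpos in auto)
  ultimately have H0: "0 < H 0" by simp
  have "\<Omega> \<noteq> {}" using AE\<Omega> assms(2) by (auto simp: AE_iff_measurable[OF sets.top])
  then obtain x0 where x0: "x0 \<in> \<Omega>" by auto
  \<comment> \<open>Each function minus the multiple of \<open>g 0\<close> with the same integral,
    so that every coordinate has mean 0.\<close>
  define Y where "Y = (\<lambda>x i. g i x - H i / H 0 * g 0 x)"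
  \<comment> \<open>Sending the null set outside \<open>\<Omega>\<close> to \<open>x0\<close> puts
    every value, not only almost every one, into the cone.\<close>
  define Y' where "Y' = (\<lambda>x. Y (if x \<in> \<Omega> then x else x0))"
  define comb where "comb = (\<lambda>ps i. \<Sum>(x, w)\<leftarrow>ps. w * Y x i)"
  \<comment> \<open>With lists, adding two combinations is appending them. Nonempty lists with
    strictly positive weights exclude the trivial zero combination, which keeps \<open>W\<close>
    below positive.\<close>
  define PS :: "('x \<times> real) list set" where "PS = {ps. ps \<noteq> [] \<and> (\<forall>(x, w)\<in>set ps. x \<in> \<Omega> \<and> 0 < w)}"
  define C where "C = comb ` PS"
  have C1: "Y' x \<in> C" for x
    unfolding C_def
    by (rule image_eqI[of _ _ "[(if x \<in> \<Omega> then x else x0, 1)]"])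
      (simp_all add: x0 comb_def PS_def Y'_def)
  have C_add: "(\<lambda>i. u i + v i) \<in> C" if uv: "u \<in> C" "v \<in> C" for u v
  proof -
    obtain ps qs where pq: "ps \<in> PS" "qs \<in> PS" "u = comb ps" "v = comb qs"
      using uv unfolding C_def by blast
    then have "ps @ qs \<in> PS" by (simp add: PS_def ball_Un)
    then show ?thesis unfolding C_def by (rule image_eqI[rotated]) (simp add: pq(3,4) comb_def)
  qed
  have C_scale: "(\<lambda>i. a * v i) \<in> C" if av: "0 < a" "v \<in> C" for a v
  proof -
    obtain ps where ps: "ps \<in> PS" "v = comb ps" using av unfolding C_def by blast
    then have "map (\<lambda>(x, w). (x, a * w)) ps \<in> PS"
      using av(1) by (auto simp: PS_def)
    then show ?thesis
      unfolding C_def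
    proof (rule image_eqI[rotated])
      show "(\<lambda>i. a * v i) = comb (map (\<lambda>(x, w). (x, a * w)) ps)"
        by (simp add: ps(2) comb_def o_def split_def mult.assoc sum_list_const_mult)
    qed
  qed
  have mY [measurable]: "(\<lambda>x. Y' x i) \<in> borel_measurable L" for i
  proof -
    have "(\<lambda>x. Y' x i) = (\<lambda>x. if x \<in> \<Omega> then g i x - H i / H 0 * g 0 x else Y x0 i)"
      by (auto simp: Y'_def Y_def)
    then show ?thesis by simp
  qed
  have YM: "Y' \<in> measurable L (restrict_space borel C)"
    using C1 by (intro measurable_restrict_space2 measurable_coordinatewise_then_product mY) auto
  have co: "(\<lambda>v. v i) \<in> borel_measurable (restrict_space borel C)" for i :: nat
    by (intro measurable_restrict_space1 borel_measurable_continuous_onI) simp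
  have aeY: "AE x in L. g i x - H i / H 0 * g 0 x = Y' x i" for i
    using AE\<Omega> by eventually_elim (auto simp: Y'_def Y_def)
  define M where "M = distr L (restrict_space borel C) Y'"
  have "\<exists>v\<in>C. \<forall>i<Suc k. v i = 0"
  proof (rule zero_mean_in_cone[of M])
    show "finite_measure M" unfolding M_def by (intro L.finite_measure_distr YM)
    have "emeasure M (space M) = emeasure L (space L)"
      unfolding M_def by (rule emeasure_space_distr[OF YM])
    then show "emeasure M (space M) \<noteq> 0" using assms by simp
    show "space M \<subseteq> C" by (simp add: M_def space_restrict_space)
    show "(\<lambda>v. v i) \<in> borel_measurable M" for i using co by (simp add: M_def)
    show "integrable M (\<lambda>v. v i)" for i
    proof -
      have "integrable L (\<lambda>x. Y' x i)"
        by (rule Bochner_Integration.integrable_cong_AE_imp[OF _ _ aeY]) auto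
      then show ?thesis unfolding M_def by (subst integrable_distr_eq) (auto simp: YM co)
    qed
    show "(\<integral>v. v i \<partial>M) = 0" for i
    proof -
      have "(\<integral>v. v i \<partial>M) = (\<integral>x. Y' x i \<partial>L)"
        unfolding M_def by (subst integral_distr) (auto simp: YM co)
      also have "\<dots> = (\<integral>x. g i x - H i / H 0 * g 0 x \<partial>L)"
        using aeY[of i] by (intro integral_cong_AE) auto
      also have "\<dots> = H i - H i / H 0 * H 0" unfolding H_def by simp
      finally show ?thesis using H0 by simp
    qed
  qed (use C_add C_scale in auto)
  then obtain v where v: "v \<in> C" "\<And>i. i < Suc k \<Longrightarrow> v i = 0" by blast
  then obtain ps where "ps \<in> PS" and v_ps: "v = comb ps" unfolding C_def by blast
  then have ps: "ps \<noteq> []" "\<forall>(x, w)\<in>set ps. x \<in> \<Omega> \<and> 0 < w" by (simp_all add: PS_def)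
  have ps0: "(\<Sum>(x, w)\<leftarrow>ps. w * Y x i) = 0" if "i < Suc k" for i
    using v(2)[OF that] by (simp add: v_ps comb_def)
  \<comment> \<open>Indexing by list positions lets a point occur several times.\<close>
  define x w where "x = (\<lambda>j. fst (ps ! j))" and "w = (\<lambda>j. snd (ps ! j))"
  define S where "S = {..<length ps}"
  have S: "finite S" "S \<noteq> {}" "\<And>j. j \<in> S \<Longrightarrow> x j \<in> \<Omega>" "\<And>j. j \<in> S \<Longrightarrow> 0 < w j"
    using ps by (auto simp: S_def x_def w_def split_def dest: nth_mem)
  have S0: "(\<Sum>j\<in>S. w j * Y (x j) i) = 0" if "i < Suc k" for i
    using ps0[OF that] by (simp add: S_def x_def w_def sum_list_sum_nth split_def lessThan_atLeast0)
  define W where "W = (\<Sum>j\<in>S. w j * g 0 (x j))"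
  have W: "0 < W" unfolding W_def using S pos by (intro sum_pos) (auto simp: g0)
  \<comment> \<open>The vanishing centred sums only make the sums of \<open>g i\<close> proportional
    to the integrals \<open>H i\<close>; the factor \<open>H 0 / W\<close> in \<open>w'\<close>
    turns this into equality.\<close>
  have W_eq: "(\<Sum>j\<in>S. w j * g i (x j)) = H i / H 0 * W" if "i < Suc k" for i
    using S0[OF that] by (simp add: Y_def W_def sum_subtractf sum_distrib_left algebra_simps)
  define w' where "w' = (\<lambda>j. H 0 / W * w j)"
  have w': "(\<Sum>j\<in>S. w' j * g i (x j)) = H i" if "i < Suc k" for i
  proof -
    have "(\<Sum>j\<in>S. w' j * g i (x j)) = H 0 / W * (\<Sum>j\<in>S. w j * g i (x j))"
      by (simp add: w'_def sum_distrib_left mult.assoc)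
    then show ?thesis using W H0 by (simp add: W_eq that)
  qed
  have "\<exists>T u. T \<subseteq> S \<and> card T \<le> k \<and> (\<forall>s\<in>T. 0 \<le> u s) \<and>
    (\<forall>i<k. (\<Sum>s\<in>T. u s * h i (x s)) = (\<Sum>s\<in>S. w' s * h i (x s))) \<and>
    (\<Sum>s\<in>S. w' s * G (x s)) \<le> (\<Sum>s\<in>T. u s * G (x s))"
  proof (rule reduce_support)
    show "0 \<le> w' s" if "s \<in> S" for s
      using S(4)[OF that] W H0 by (simp add: w'_def)
  qed (use S pos assms(3) in auto)
  then obtain T u where T: "T \<subseteq> S" "card T \<le> k" "\<forall>s\<in>T. 0 \<le> u s"
      "\<forall>i<k. (\<Sum>s\<in>T. u s * h i (x s)) = (\<Sum>s\<in>S. w' s * h i (x s))"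
      "(\<Sum>s\<in>S. w' s * G (x s)) \<le> (\<Sum>s\<in>T. u s * G (x s))"
    by blast
  have "finite T" using T S finite_subset by blast
  then obtain b where b: "bij_betw b {1..card T} T" using ex_bij_betw_nat_finite_1 by blast
  \<comment> \<open>Fewer than \<open>k\<close> points may remain; the list is filled up with
    \<open>x0\<close> at weight 0.\<close>
  define s where "s = (\<lambda>j. if j \<le> card T then x (b j) else x0)"
  define y where "y = (\<lambda>j. if j \<le> card T then u (b j) else 0)"
  have eq: "(\<Sum>j=1..k. y j * a (s j)) = (\<Sum>j\<in>T. u j * a (x j))" for a
  proof -
    have "(\<Sum>j=1..k. y j * a (s j)) = (\<Sum>j=1..card T. y j * a (s j))"
      using T by (intro sum.mono_neutral_right) (auto simp: y_def)
    also have "\<dots> = (\<Sum>j=1..card T. u (b j) * a (x (b j)))"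
      by (intro sum.cong) (auto simp: y_def s_def)
    also have "\<dots> = (\<Sum>j\<in>T. u j * a (x j))"
      using sum.reindex_bij_betw[OF b, of "\<lambda>j. u j * a (x j)"] by simp
    finally show ?thesis .
  qed
  have "s j \<in> \<Omega> \<and> 0 \<le> y j" if "j \<in> {1..k}" for j
  proof (cases "j \<le> card T")
    case True
    then have "b j \<in> T" using that bij_betwE[OF b] by auto
    then show ?thesis using True T(1,3) S(3)[of "b j"] by (auto simp: s_def y_def)
  qed (simp add: s_def y_def x0)
  moreover have "(\<Sum>j=1..k. y j * h i (s j)) = integral\<^sup>L L (h i)" if "i < k" for i
    unfolding eq using that T w'[of i] by (simp add: g_def H_def)
  moreover have "integral\<^sup>L L G \<le> (\<Sum>j=1..k. y j * G (s j))"
    unfolding eq using T w'[of k] by (simp add: g_def H_def)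
  ultimately show ?thesis by (intro exI[of _ s] exI[of _ y]) auto
qed

section \<open>Perspective functions and divergences\<close>

lemma ereal_tendsto_at_right_0:
  fixes g :: "real \<Rightarrow> real"
  assumes "\<And>x y. 0 < x \<Longrightarrow> x \<le> y \<Longrightarrow> y \<le> 1 \<Longrightarrow> g y \<le> g x"
  shows "((\<lambda>x. ereal (g x)) \<longlongrightarrow> (SUP x\<in>{0<..1}. ereal (g x))) (at_right 0)"
proof (rule order_tendstoI)
  fix a assume "a < (SUP x\<in>{0<..1}. ereal (g x))"
  then obtain y where y: "0 < y" "y \<le> 1" "a < ereal (g y)" by (auto simp: less_SUP_iff)
  show "\<forall>\<^sub>F x in at_right 0. a < ereal (g x)"
    unfolding eventually_at_right_field
    by (intro exI[of _ y]) (use y assms in \<open>force intro: less_le_trans\<close>)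
next
  fix a assume "(SUP x\<in>{0<..1}. ereal (g x)) < a"
  then have "ereal (g x) < a" if "x \<in> {0<..1}" for x
    using that by (rule le_less_trans[OF SUP_upper, rotated])
  then show "\<forall>\<^sub>F x in at_right 0. ereal (g x) < a"
    unfolding eventually_at_right_field by (intro exI[of _ 1]) auto
qed

lemma ereal_tendsto_at_top:
  fixes g :: "real \<Rightarrow> real"
  assumes "\<And>x y. 1 \<le> x \<Longrightarrow> x \<le> y \<Longrightarrow> g x \<le> g y"
  shows "((\<lambda>x. ereal (g x)) \<longlongrightarrow> (SUP x\<in>{1..}. ereal (g x))) at_top"
proof (rule order_tendstoI)
  fix a assume "a < (SUP x\<in>{1..}. ereal (g x))"
  then obtain y where y: "1 \<le> y" "a < ereal (g y)" by (auto simp: less_SUP_iff)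
  show "\<forall>\<^sub>F x in at_top. a < ereal (g x)"
    using eventually_ge_at_top[of y] by eventually_elim (use y assms in \<open>force intro: less_le_trans\<close>)
next
  fix a assume "(SUP x\<in>{1..}. ereal (g x)) < a"
  then have *: "ereal (g x) < a" if "x \<in> {1..}" for x
    using that by (rule le_less_trans[OF SUP_upper, rotated])
  show "\<forall>\<^sub>F x in at_top. ereal (g x) < a"
    using eventually_ge_at_top[of 1] by eventually_elim (use * in auto)
qed

text \<open>\<open>Lim\<close> is informative only once convergence is known. A nonnegative convex
  function vanishing at 1 decreases on \<open>(0, 1]\<close>, so its limit at 0 is a
  supremum.\<close>

lemma convex_on_tendsto_value_at_0:
  assumes g: "convex_on {0<..} g" "g 1 = 0" "\<And>x. 0 < x \<Longrightarrow> 0 \<le> g x"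
  shows "((\<lambda>x. ereal (g x)) \<longlongrightarrow> value_at_0 g) (at_right 0)"
proof -
  have mono: "g y \<le> g x" if xy: "0 < x" "x \<le> y" "y \<le> 1" for x y
  proof (cases "x < 1")
    case True
    define t where "t = (y - x) / (1 - x)"
    have t: "0 \<le> t" "t \<le> 1" using xy True by (auto simp: t_def)
    have "t * (1 - x) = y - x" using True by (simp add: t_def)
    then have yt: "y = (1 - t) * x + t * 1" by (simp add: algebra_simps)
    have "g y \<le> (1 - t) * g x + t * g 1"
      using convex_onD[OF g(1) t, of x 1] xy yt by simp
    also have "\<dots> \<le> 1 * g x" using g t xy by (simp add: mult_right_mono algebra_simps)
    finally show ?thesis by simp
  next
    case False
    then have "x = y" using xy by simp
    then show ?thesis by simp
  qed
  from ereal_tendsto_at_right_0[of g, OF mono] show ?thesis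
    unfolding value_at_0_def by (simp add: tendsto_Lim)
qed

text \<open>The quotient \<open>g x / x\<close> increases on \<open>[1, \<infinity>)\<close>:
  convexity between 1 and \<open>y\<close> with \<open>g 1 = 0\<close> gives
  \<open>g x \<le> t * g y\<close>, and \<open>t \<le> x / y\<close> with \<open>g y \<ge> 0\<close>
  does the rest.\<close>

lemma convex_on_tendsto_slope_at_infinity:
  assumes g: "convex_on {0<..} g" "g 1 = 0" "\<And>x. 0 < x \<Longrightarrow> 0 \<le> g x"
  shows "((\<lambda>x. ereal (g x / x)) \<longlongrightarrow> slope_at_infinity g) at_top"
proof -
  have mono: "g x / x \<le> g y / y" if xy: "1 \<le> x" "x \<le> y" for x y
  proof (cases "1 < x")
    case True
    define t where "t = (x - 1) / (y - 1)"
    have t: "0 \<le> t" "t \<le> 1" "t \<le> x / y"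
      using xy True by (auto simp: t_def field_simps)
    have "t * (y - 1) = x - 1" using True xy by (simp add: t_def)
    then have xt: "x = (1 - t) * 1 + t * y" by (simp add: algebra_simps)
    have "g x \<le> (1 - t) * g 1 + t * g y"
      using convex_onD[OF g(1) t(1,2), of 1 y] xy xt by simp
    also have "\<dots> \<le> x / y * g y"
      using mult_right_mono[OF t(3), of "g y"] g(2,3) xy by simp
    finally show ?thesis using xy by (simp add: field_simps)
  next
    case False
    then show ?thesis using xy g by simp
  qed
  from ereal_tendsto_at_top[of "\<lambda>x. g x / x", OF mono] show ?thesis
    unfolding slope_at_infinity_def by (simp add: tendsto_Lim)
qed

text \<open>
  Subtracting a supporting line at \<open>1\<close> makes the generator nonnegative and does not change the
  divergence between probability measures.
\<close>

definition tilt :: "(real \<Rightarrow> real) \<Rightarrow> real \<Rightarrow> real" where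
  "tilt f x = f x - (SOME c. \<forall>y>0. c * (y - 1) \<le> f y) * (x - 1)"

lemma tilt:
  assumes f: "convex_on {0<..} f" "f 1 = 0"
  shows "convex_on {0<..} (tilt f)" "tilt f 1 = 0" "\<And>x. 0 < x \<Longrightarrow> 0 \<le> tilt f x"
    and "\<exists>c. \<forall>x. f x = tilt f x + c * (x - 1)"
proof -
  define c where "c = (SOME c. \<forall>y>0. c * (y - 1) \<le> f y)"
  \<comment> \<open>1 is interior to the domain, so a supporting line exists there, and it passes
    through \<open>f 1 = 0\<close>.\<close>
  have "\<exists>c. \<forall>y>0. c * (y - 1) \<le> f y"
    using convex_le_Inf_differential[OF f(1), of 1] f(2) by (auto simp: interior_open)
  then have c: "\<forall>y>0. c * (y - 1) \<le> f y" unfolding c_def by (rule someI_ex)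
  have t: "tilt f x = f x - c * (x - 1)" for x by (simp add: tilt_def c_def)
  show "tilt f 1 = 0" "\<And>x. 0 < x \<Longrightarrow> 0 \<le> tilt f x" "\<exists>c. \<forall>x. f x = tilt f x + c * (x - 1)"
    using c f by (auto simp: t intro!: exI[of _ c])
  show "convex_on {0<..} (tilt f)"
  proof (rule convex_onI)
    fix u x y :: real assume u: "0 < u" "u < 1" and xy: "x \<in> {0<..}" "y \<in> {0<..}"
    have "f ((1 - u) *\<^sub>R x + u *\<^sub>R y) \<le> (1 - u) * f x + u * f y"
      using convex_onD[OF f(1)] u xy by simp
    then show "tilt f ((1 - u) *\<^sub>R x + u *\<^sub>R y) \<le> (1 - u) * tilt f x + u * tilt f y"
      by (simp add: t algebra_simps)
  qed simp
qed

text \<open>The linear part tends to \<open>- c\<close> at 0 and, divided by \<open>x\<close>, to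
  \<open>c\<close> at infinity. These finite limits may be added to possibly infinite ones, so
  convergence passes from nonnegative generators to general ones.\<close>

lemma
  assumes g: "convex_on {0<..} g" "g 1 = 0" "\<And>x. 0 < x \<Longrightarrow> 0 \<le> g x"
    and f: "\<And>x. f x = g x + c * (x - 1)"
  shows value_at_0_add: "value_at_0 f = value_at_0 g - ereal c"
    and slope_at_infinity_add: "slope_at_infinity f = slope_at_infinity g + ereal c"
proof -
  have "((\<lambda>x. ereal (g x) + ereal (c * (x - 1))) \<longlongrightarrow> value_at_0 g + ereal (c * (0 - 1))) (at_right 0)"
    by (intro tendsto_add_ereal_general convex_on_tendsto_value_at_0 g tendsto_ereal tendsto_intros) auto
  then show "value_at_0 f = value_at_0 g - ereal c"
    unfolding value_at_0_def[of f] by (intro tendsto_Lim) (auto simp: f minus_ereal_def)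
  have "((\<lambda>x. c - c / x) \<longlongrightarrow> c - 0) at_top"
    by (intro tendsto_diff tendsto_const tendsto_divide_0[OF tendsto_const]
        filterlim_at_top_imp_at_infinity filterlim_ident)
  moreover have "\<forall>\<^sub>F x in at_top. c - c / x = c * (x - 1) / x"
    using eventually_gt_at_top[of 0] by eventually_elim (simp add: field_simps)
  ultimately have "((\<lambda>x. c * (x - 1) / x) \<longlongrightarrow> c - 0) at_top"
    by (rule Lim_transform_eventually)
  then have "((\<lambda>x. c * (x - 1) / x) \<longlongrightarrow> c) at_top" by simp
  then have "((\<lambda>x. ereal (g x / x) + ereal (c * (x - 1) / x)) \<longlongrightarrow> slope_at_infinity g + ereal c) at_top"
    by (intro tendsto_add_ereal_general convex_on_tendsto_slope_at_infinity g tendsto_ereal) auto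
  then show "slope_at_infinity f = slope_at_infinity g + ereal c"
    unfolding slope_at_infinity_def[of f] by (intro tendsto_Lim) (auto simp: f add_divide_distrib)
qed

lemma
  assumes g: "convex_on {0<..} g" "g 1 = 0" "\<And>x. 0 < x \<Longrightarrow> 0 \<le> g x"
  shows value_at_0_nonneg: "0 \<le> value_at_0 g"
    and slope_at_infinity_nonneg: "0 \<le> slope_at_infinity g"
proof -
  show "0 \<le> value_at_0 g"
    using convex_on_tendsto_value_at_0[OF g]
    by (rule tendsto_lowerbound) (auto intro!: eventually_mono[OF eventually_at_right_less] g)
  show "0 \<le> slope_at_infinity g"
    using convex_on_tendsto_slope_at_infinity[OF g]
    by (rule tendsto_lowerbound) (auto intro!: eventually_mono[OF eventually_gt_at_top[of 0]] divide_nonneg_pos g)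
qed

section \<open>The divergence as an integral of the perspective\<close>

text \<open>The relation between positive and negative parts is written without subtraction, so it
  survives infinite values; \<open>hp\<close>, \<open>hm\<close> and \<open>B\<close> are finite and
  can be moved across afterwards.\<close>

lemma ereal_integral_add_integrable:
  assumes e [measurable]: "e \<in> borel_measurable M" and e0: "\<And>x. 0 \<le> e x" and h: "integrable M h"
  shows "ereal_integral M (\<lambda>x. e x + ereal (h x)) =
    enn2ereal (\<integral>\<^sup>+x. e2ennreal (e x) \<partial>M) + ereal (integral\<^sup>L M h)"
proof -
  have [measurable]: "h \<in> borel_measurable M" using h by simp
  define hp hm where "hp = (\<integral>\<^sup>+x. ennreal (h x) \<partial>M)" and "hm = (\<integral>\<^sup>+x. ennreal (- h x) \<partial>M)"
  define X where "X = (\<integral>\<^sup>+x. e2ennreal (e x) \<partial>M)"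
  define A where "A = (\<integral>\<^sup>+x. e2ennreal (e x + ereal (h x)) \<partial>M)"
  define B where "B = (\<integral>\<^sup>+x. e2ennreal (- (e x + ereal (h x))) \<partial>M)"
  have fin: "hp < \<infinity>" "hm < \<infinity>"
    using h by (auto simp: hp_def hm_def real_integrable_def less_top)
  have ih: "integral\<^sup>L M h = enn2real hp - enn2real hm"
    unfolding hp_def hm_def by (rule real_lebesgue_integral_def[OF h])
  \<comment> \<open>Adding the nonnegative \<open>e\<close> can only shrink the negative part of
    \<open>h\<close>.\<close>
  have "e2ennreal (- (e x + ereal (h x))) \<le> ennreal (- h x)" for x
    using e0[of x] by (cases "e x") (auto intro!: ennreal_leI simp: e2ennreal_neg)
  then have "B \<le> hm" unfolding B_def hm_def by (intro nn_integral_mono)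
  with fin have B: "B < \<infinity>" by auto
  have pw: "e2ennreal (e x + ereal (h x)) + ennreal (- h x)
      = e2ennreal (e x) + ennreal (h x) + e2ennreal (- (e x + ereal (h x)))" for x
  proof (cases "e x")
    case (real r)
    then have r: "0 \<le> r" using e0[of x] by simp
    consider "0 \<le> h x" | "h x < 0" "0 \<le> r + h x" | "r + h x < 0" by linarith
    then show ?thesis
      using r by cases (simp_all add: real ennreal_neg ennreal_plus[symmetric] del: ennreal_plus)
  next
    case PInf
    then show ?thesis by (simp add: e2ennreal_infty)
  qed (use e0[of x] in auto)
  have "A + hm = X + hp + B"
    unfolding A_def hm_def X_def hp_def B_def
    by (simp add: nn_integral_add[symmetric] pw)
  then have "enn2ereal A + enn2ereal hm = enn2ereal X + enn2ereal hp + enn2ereal B"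
    by (simp add: plus_ennreal.rep_eq[symmetric])
  moreover obtain b where "enn2ereal B = ereal b" using B by (cases B rule: ennreal_cases) auto
  moreover obtain y where "enn2ereal hm = ereal y" "enn2real hm = y"
    using fin by (cases hm rule: ennreal_cases) auto
  moreover obtain z where "enn2ereal hp = ereal z" "enn2real hp = z"
    using fin by (cases hp rule: ennreal_cases) auto
  ultimately have "enn2ereal A - enn2ereal B = enn2ereal X + ereal (integral\<^sup>L M h)"
    unfolding ih by (cases "enn2ereal A"; cases "enn2ereal X") auto
  then show ?thesis
    by (simp add: ereal_integral_def A_def B_def X_def)
qed

text \<open>Tilting makes the values nonnegative, so they lie in \<open>ennreal\<close> and every
  integral exists. The omitted term \<open>c * (p - q)\<close>, with \<open>c\<close> the tilting
  slope, integrates to 0 for two probability densities.\<close>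

definition perspective :: "(real \<Rightarrow> real) \<Rightarrow> real \<Rightarrow> real \<Rightarrow> ennreal" where
  "perspective f p q =
    (if 0 < q then ennreal q * e2ennreal (extend_to_0 (tilt f) (p / q))
     else ennreal p * e2ennreal (slope_at_infinity (tilt f)))"

lemma perspective_scale:
  assumes "0 \<le> w" "0 \<le> p" "0 \<le> q"
  shows "perspective f (w * p) (w * q) = ennreal w * perspective f p q"
\<comment> \<open>Scaling by 0 moves a point with \<open>q > 0\<close> into the branch for
  \<open>q = 0\<close>; both sides are 0 because \<open>0 * \<infinity> = 0\<close> in
  \<open>ennreal\<close>.\<close>
proof (cases "w = 0")
  case False
  then show ?thesis
    using assms by (simp add: perspective_def ennreal_mult mult.assoc zero_less_mult_iff)
qed (simp add: perspective_def)

lemma borel_measurable_extend_to_0: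
  assumes "convex_on {0<..} g"
  shows "extend_to_0 g \<in> borel_measurable borel"
proof -
  have "continuous_on {0<..} g" using assms by (intro convex_on_continuous) auto
  then have "(\<lambda>x. if x \<in> {0<..} then ereal (g x) else value_at_0 g) \<in> borel_measurable borel"
    by (intro borel_measurable_continuous_on_if continuous_on_ereal continuous_on_const) auto
  then show ?thesis by (simp add: extend_to_0_def[abs_def])
qed

lemma borel_measurable_perspective:
  assumes f: "convex_on {0<..} f" "f 1 = 0"
    and [measurable]: "p \<in> borel_measurable L" "q \<in> borel_measurable L"
  shows "(\<lambda>x. perspective f (p x) (q x)) \<in> borel_measurable L"
proof -
  note [measurable] = borel_measurable_extend_to_0[OF tilt(1)[OF f]]
  show ?thesis unfolding perspective_def by measurable
qed

lemma integral_prob_density: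
  assumes [measurable]: "p \<in> borel_measurable L" and p0: "\<And>x. 0 \<le> p x"
    and P: "P = density L (\<lambda>x. ennreal (p x))" "prob_space P"
  shows "integrable L p" "integral\<^sup>L L p = 1"
proof -
  have 1: "(\<integral>\<^sup>+x. ennreal (p x) \<partial>L) = 1"
    using prob_space.emeasure_space_1[OF P(2)] by (simp add: P(1) emeasure_density cong: nn_integral_cong)
  show "integrable L p"
    using 1 p0 by (intro integrableI_nonneg) auto
  show "integral\<^sup>L L p = 1" 
    using 1 p0 by (subst integral_eq_nn_integral) auto
qed

text \<open>Let \<open>c\<close> be the tilting slope and \<open>b\<close> the mass that
  \<open>P\<close> gives to \<open>q = 0\<close>. The linear part contributes
  \<open>- (c * b)\<close> to the integral over \<open>q > 0\<close> and \<open>c * b\<close> to the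
  singular term, so it cancels.\<close>

lemma f_divergence_perspective:
  assumes f: "convex_on {0<..} f" "f 1 = 0"
    and L: "sigma_finite_measure L"
    and p [measurable]: "p \<in> borel_measurable L" and p0: "\<And>x. 0 \<le> p x"
    and q [measurable]: "q \<in> borel_measurable L" and q0: "\<And>x. 0 \<le> q x"
    and P: "P = density L (\<lambda>x. ennreal (p x))" and Q: "Q = density L (\<lambda>x. ennreal (q x))"
    and PQ: "prob_space P" "prob_space Q"
  shows "f_divergence f P Q = enn2ereal (\<integral>\<^sup>+x. perspective f (p x) (q x) \<partial>L)"
proof -
  interpret P: prob_space P by fact
  interpret Q: prob_space Q by fact
  define g where "g = tilt f"
  note g = tilt(1-3)[OF f, folded g_def]
  obtain c where fg: "\<And>x. f x = g x + c * (x - 1)" using tilt(4)[OF f] by (auto simp: g_def)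
  note [measurable] = borel_measurable_extend_to_0[OF g(1)]
  have sets [measurable_cong, simp]: "sets P = sets L" "sets Q = sets L" by (auto simp: P Q)
  have sp [simp]: "space P = space L" "space Q = space L" by (auto simp: P Q)
  define e where "e = (\<lambda>x. if 0 < q x then extend_to_0 g (p x / q x) else 0)"
  define h where "h = (\<lambda>x. if 0 < q x then c * (p x / q x - 1) else 0)"
  have [measurable]: "e \<in> borel_measurable L" "h \<in> borel_measurable L"
    unfolding e_def h_def by measurable
  have e0: "0 \<le> e x" for x
    using g(3) value_at_0_nonneg[OF g] by (auto simp: e_def extend_to_0_def)
  have v0: "value_at_0 f = value_at_0 g - ereal c" by (rule value_at_0_add[OF g fg])
  have slope: "slope_at_infinity f = slope_at_infinity g + ereal c" by (rule slope_at_infinity_add[OF g fg])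
  have extend: "extend_to_0 f y = extend_to_0 g y + ereal (c * (y - 1))" if "0 \<le> y" for y
  proof (cases "0 < y")
    case True
    then show ?thesis by (simp add: extend_to_0_def fg)
  next
    case False
    then show ?thesis
      using that by (simp add: extend_to_0_def v0 minus_ereal_def)
  qed
  have ext: "(if 0 < q x then extend_to_0 f (p x / q x) else 0) = e x + ereal (h x)" for x
    using p0[of x] extend[of "p x / q x"] by (simp add: e_def h_def)
  define b where "b = measure P {x \<in> space P. q x = 0}"
  have ip: "integrable L p" "integral\<^sup>L L p = 1" and iq: "integrable L q" "integral\<^sup>L L q = 1"
    using integral_prob_density[OF p p0 P PQ(1)] integral_prob_density[OF q q0 Q PQ(2)] by auto
  have pos: "(\<integral>x. indicator {x \<in> space L. 0 < q x} x * p x \<partial>L) = 1 - b"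
  proof -
    have "1 - b = measure P {x \<in> space P. \<not> q x = 0}"
      unfolding b_def by (subst P.prob_neg) auto
    also have "{x \<in> space P. \<not> q x = 0} = {x \<in> space L. 0 < q x}"
      using q0 by (auto simp: less_le)
    also have "measure P {x \<in> space L. 0 < q x} = (\<integral>x. indicator {x \<in> space L. 0 < q x} x \<partial>P)"
      by simp
    also have "\<dots> = (\<integral>x. p x * indicator {x \<in> space L. 0 < q x} x \<partial>L)"
      unfolding P using p0 by (subst integral_density) auto
    finally show ?thesis by (simp add: mult.commute)
  qed
  have qh: "q x * h x = c * (indicator {x \<in> space L. 0 < q x} x * p x - q x)" if "x \<in> space L" for x
    using q0[of x] that by (cases "q x = 0") (auto simp: h_def field_simps indicator_def)
  have ind: "integrable L (\<lambda>x. indicator {x \<in> space L. 0 < q x} x * p x)"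
    using integrable_mult_indicator[OF _ ip(1), of "{x \<in> space L. 0 < q x}"] by simp
  have "integrable L (\<lambda>x. q x * h x) \<longleftrightarrow>
      integrable L (\<lambda>x. c * (indicator {x \<in> space L. 0 < q x} x * p x - q x))"
    by (intro Bochner_Integration.integrable_cong refl qh)
  then have ihL: "integrable L (\<lambda>x. q x * h x)" using ind iq by simp
  then have ih: "integrable Q h" unfolding Q using q0 by (subst integrable_density) auto
  have "integral\<^sup>L Q h = (\<integral>x. q x * h x \<partial>L)"
    unfolding Q using q0 by (subst integral_density) auto
  also have "\<dots> = (\<integral>x. c * (indicator {x \<in> space L. 0 < q x} x * p x - q x) \<partial>L)"
    by (intro Bochner_Integration.integral_cong refl qh)
  also have "\<dots> = c * ((1 - b) - 1)" using ind iq pos by simp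
  also have "\<dots> = - (c * b)" by simp
  finally have inth: "integral\<^sup>L Q h = - (c * b)" .
  define E where "E = (\<integral>\<^sup>+x. e2ennreal (e x) \<partial>Q)"
  have eqint: "ereal_integral Q (\<lambda>x. if 0 < q x then extend_to_0 f (p x / q x) else 0)
      = enn2ereal E + ereal (- (c * b))"
    unfolding ext E_def inth[symmetric] by (rule ereal_integral_add_integrable) (use e0 ih in auto)
  have s0: "0 \<le> slope_at_infinity g" by (rule slope_at_infinity_nonneg[OF g])
  have b0: "0 \<le> b" by (simp add: b_def)
  have "f_divergence f P Q = enn2ereal E + ereal (- (c * b)) + (slope_at_infinity g + ereal c) * ereal b"
    unfolding f_divergence_eq[OF L p p0 q q0 P Q PQ] f_divergence_densities_def eqint
    by (simp add: b_def slope)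
  \<comment> \<open>Only the real number \<open>c * b\<close> is cancelled, so infinite
    \<open>E\<close> or slope do no harm; for \<open>b = 0\<close> an infinite slope is multiplied
    by 0.\<close>
  also have "\<dots> = enn2ereal E + slope_at_infinity g * ereal b"
    using s0 b0 by (cases "slope_at_infinity g"; cases "b = 0"; cases "enn2ereal E")
      (auto simp: algebra_simps)
  also have "slope_at_infinity g * ereal b = enn2ereal (e2ennreal (slope_at_infinity g) * ennreal b)"
    using s0 b0 by (simp add: times_ennreal.rep_eq enn2ereal_e2ennreal)
  also have "enn2ereal E + \<dots> = enn2ereal (E + e2ennreal (slope_at_infinity g) * ennreal b)"
    by (simp add: plus_ennreal.rep_eq)
  also have "ennreal b = (\<integral>\<^sup>+x. ennreal (p x) * indicator {x \<in> space L. q x = 0} x \<partial>L)"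
    unfolding b_def P.emeasure_eq_measure[symmetric] by (simp add: P emeasure_density)
  also have "E = (\<integral>\<^sup>+x. ennreal (q x) * e2ennreal (e x) \<partial>L)"
    unfolding E_def Q by (subst nn_integral_density) auto
  also have "(\<integral>\<^sup>+x. ennreal (q x) * e2ennreal (e x) \<partial>L) + e2ennreal (slope_at_infinity g) *
        (\<integral>\<^sup>+x. ennreal (p x) * indicator {x \<in> space L. q x = 0} x \<partial>L)
      = (\<integral>\<^sup>+x. ennreal (q x) * e2ennreal (e x) + e2ennreal (slope_at_infinity g) *
        (ennreal (p x) * indicator {x \<in> space L. q x = 0} x) \<partial>L)"
    by (subst nn_integral_add) (auto simp: nn_integral_cmult)
  also have "\<dots> = (\<integral>\<^sup>+x. perspective f (p x) (q x) \<partial>L)"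
  proof (intro nn_integral_cong)
    fix x assume "x \<in> space L"
    then show "ennreal (q x) * e2ennreal (e x) + e2ennreal (slope_at_infinity g) *
        (ennreal (p x) * indicator {x \<in> space L. q x = 0} x) = perspective f (p x) (q x)"
      using q0[of x] by (cases "q x = 0") (auto simp: perspective_def e_def g_def mult.commute)
  qed
  finally show ?thesis .
qed

text \<open>For \<open>L = P + Q\<close>, the set where both densities vanish is null for
  \<open>P\<close> and for \<open>Q\<close>, hence for \<open>L\<close>. This makes
  \<open>p + q\<close> available as the positive coordinate that
  \<open>finite_representation\<close> demands.\<close>

lemma prob_pair_densities:
  assumes PQ: "prob_space P" "prob_space Q" "sets P = sets Q"
  obtains L :: "'a measure" and p q :: "'a \<Rightarrow> real" where
    "finite_measure L" "emeasure L (space L) \<noteq> 0"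
    "p \<in> borel_measurable L" "\<And>x. 0 \<le> p x" "q \<in> borel_measurable L" "\<And>x. 0 \<le> q x"
    "P = density L (\<lambda>x. ennreal (p x))" "Q = density L (\<lambda>x. ennreal (q x))"
    "AE x in L. 0 < p x + q x"
proof -
  interpret P: prob_space P by fact
  interpret Q: prob_space Q by fact
  define L where "L = sum_measure P Q"
  have em: "emeasure L A = emeasure P A + emeasure Q A" if "A \<in> sets P" for A
    using emeasure_sum_measure[OF PQ(3) that] by (simp add: L_def)
  have s: "sets L = sets P" "sets Q = sets L" "space L = space P" "space Q = space P"
    using PQ(3) sets_eq_imp_space_eq[OF PQ(3)] by (auto simp: L_def)
  have sp: "emeasure L (space L) = 2"
    using em[OF sets.top] P.emeasure_space_1 Q.emeasure_space_1 s by simp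
  have fin: "finite_measure L" by (rule finite_measureI) (simp add: sp)
  interpret L: finite_measure L by fact
  have ac: "absolutely_continuous L P" "absolutely_continuous L Q"
    using em s by (auto simp: absolutely_continuous_def null_sets_def)
  obtain p where p: "p \<in> borel_measurable L" "AE x in L. RN_deriv L P x = ennreal (p x)"
    "AE x in P. 0 < p x" "\<And>x. 0 \<le> p x"
    using L.real_RN_deriv[OF P.finite_measure_axioms ac(1)] s by metis
  obtain q where q: "q \<in> borel_measurable L" "AE x in L. RN_deriv L Q x = ennreal (q x)"
    "AE x in Q. 0 < q x" "\<And>x. 0 \<le> q x"
    using L.real_RN_deriv[OF Q.finite_measure_axioms ac(2)] s by metis
  note [measurable] = p(1) q(1)
  have P: "P = density L (\<lambda>x. ennreal (p x))"
    using L.density_RN_deriv[OF ac(1)] s density_cong[OF _ _ p(2)] by simp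
  have Q: "Q = density L (\<lambda>x. ennreal (q x))"
    using L.density_RN_deriv[OF ac(2)] s density_cong[OF _ _ q(2)] by simp
  have N: "{x \<in> space L. \<not> 0 < p x + q x} \<in> sets L" by measurable
  have "emeasure P {x \<in> space L. \<not> 0 < p x + q x} = 0"
  proof -
    have "AE x in P. 0 < p x + q x" using p(3) by eventually_elim (use q(4) in \<open>auto intro: add_pos_nonneg\<close>)
    then show ?thesis using N s AE_iff_measurable[of _ P "\<lambda>x. 0 < p x + q x"] by simp
  qed
  moreover have "emeasure Q {x \<in> space L. \<not> 0 < p x + q x} = 0"
  proof -
    have "AE x in Q. 0 < p x + q x" using q(3) by eventually_elim (use p(4) in \<open>auto intro: add_nonneg_pos\<close>)
    then show ?thesis using N s AE_iff_measurable[of _ Q "\<lambda>x. 0 < p x + q x"] by simp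
  qed
  ultimately have "emeasure L {x \<in> space L. \<not> 0 < p x + q x} = 0"
    using em N s by simp
  then have "AE x in L. 0 < p x + q x" by (simp add: AE_iff_measurable[OF N refl])
  then show ?thesis using that[OF fin _ p(1) p(4) q(1) q(4) P Q] sp by simp
qed

lemma
  fixes T :: "'t set" and p q :: "'t \<Rightarrow> real"
  assumes T: "finite T" and p: "\<And>t. 0 \<le> p t" "sum p T = 1" and q: "\<And>t. 0 \<le> q t" "sum q T = 1"
  shows prob_space_density_count_space: "prob_space (density (count_space T) (\<lambda>t. ennreal (p t)))"
    and f_divergence_count_space: "convex_on {0<..} f \<Longrightarrow> f 1 = 0 \<Longrightarrow>
      f_divergence f (density (count_space T) (\<lambda>t. ennreal (p t))) (density (count_space T) (\<lambda>t. ennreal (q t)))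
      = enn2ereal (\<Sum>t\<in>T. perspective f (p t) (q t))"
proof -
  have pr: "prob_space (density (count_space T) (\<lambda>t. ennreal (r t)))"
    if "\<And>t. 0 \<le> r t" "sum r T = 1" for r :: "'t \<Rightarrow> real"
    using that T by (intro prob_spaceI)
      (simp add: emeasure_density nn_integral_count_space_finite cong: sum.cong)
  show "prob_space (density (count_space T) (\<lambda>t. ennreal (p t)))" by (rule pr[OF p])
  assume f: "convex_on {0<..} f" "f 1 = 0"
  show "f_divergence f (density (count_space T) (\<lambda>t. ennreal (p t))) (density (count_space T) (\<lambda>t. ennreal (q t)))
      = enn2ereal (\<Sum>t\<in>T. perspective f (p t) (q t))"
    using T p q
    by (subst f_divergence_perspective[where L = "count_space T" and p = p and q = q, OF f])
      (auto intro!: pr sigma_finite_measure_count_space_finite simp: nn_integral_count_space_finite)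
qed

section \<open>Reduction to finitely many atoms\<close>

text \<open>Cut off at level \<open>n\<close>, \<open>\<phi>\<close> becomes bounded and hence
  integrable over the finite measure \<open>L\<close>; monotone convergence lifts the integrals
  above any \<open>c\<close> strictly below that of \<open>\<phi>\<close>.\<close>

lemma nn_integral_truncate:
  assumes "finite_measure L" and [measurable]: "\<phi> \<in> borel_measurable L"
    and c: "c < (\<integral>\<^sup>+x. \<phi> x \<partial>L)"
  shows "\<exists>r. integrable L r \<and> (\<forall>x. 0 \<le> r x \<and> ennreal (r x) \<le> \<phi> x) \<and> c < ennreal (integral\<^sup>L L r)"
proof -
  interpret finite_measure L by fact
  have sup: "(SUP n. min (\<phi> x) (of_nat n)) = \<phi> x" for x
  proof (rule antisym)
    show "\<phi> x \<le> (SUP n. min (\<phi> x) (of_nat n))"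
    proof (rule le_SUP_iff[THEN iffD2], intro allI impI)
      fix y assume "y < \<phi> x"
      moreover from this have "y < top" by (rule less_le_trans) simp
      then obtain n where "y < of_nat n" using ennreal_Ex_less_of_nat[of y] by auto
      ultimately show "\<exists>n\<in>UNIV. y < min (\<phi> x) (of_nat n)" by auto
    qed
  qed (auto intro: SUP_least)
  have "(\<integral>\<^sup>+x. \<phi> x \<partial>L) = (\<integral>\<^sup>+x. (SUP n. min (\<phi> x) (of_nat n)) \<partial>L)" by (simp add: sup)
  also have "\<dots> = (SUP n. \<integral>\<^sup>+x. min (\<phi> x) (of_nat n) \<partial>L)"
    by (intro nn_integral_monotone_convergence_SUP)
      (auto simp: incseq_def le_fun_def intro: min.coboundedI2 min.coboundedI1)
  finally obtain n :: nat where n: "c < (\<integral>\<^sup>+x. min (\<phi> x) (of_nat n) \<partial>L)"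
    using c by (auto simp: less_SUP_iff)
  define r where "r = (\<lambda>x. enn2real (min (\<phi> x) (of_nat n)))"
  have r: "ennreal (r x) = min (\<phi> x) (of_nat n)" for x
    unfolding r_def by (intro ennreal_enn2real) (simp add: min_less_iff_disj of_nat_less_top)
  have [measurable]: "r \<in> borel_measurable L" unfolding r_def by measurable
  have r0: "0 \<le> r x" for x by (simp add: r_def)
  have "r x \<le> real n" for x
    using r[of x] by (metis ennreal_le_iff ennreal_of_nat_eq_real_of_nat min.cobounded2 of_nat_0_le_iff)
  then have int: "integrable L r"
    using r0 by (intro integrable_const_bound[of _ "real n"]) auto
  have "c < ennreal (integral\<^sup>L L r)"
    using n nn_integral_eq_integral[OF int] r0 by (simp add: r)
  then show ?thesis using int r r0 by (intro exI[of _ r]) auto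
qed

lemma integrable_enn2real:
  assumes [measurable]: "\<phi> \<in> borel_measurable L" and fin: "(\<integral>\<^sup>+x. \<phi> x \<partial>L) < \<infinity>"
  shows "integrable L (\<lambda>x. enn2real (\<phi> x))"
    and "ennreal (\<integral>x. enn2real (\<phi> x) \<partial>L) = (\<integral>\<^sup>+x. \<phi> x \<partial>L)"
    and "AE x in L. \<phi> x < \<infinity>"
proof -
  show ae: "AE x in L. \<phi> x < \<infinity>"
    using nn_integral_noteq_infinite[of \<phi> L] fin by (auto simp: less_top)
  have eq: "(\<integral>\<^sup>+x. ennreal (enn2real (\<phi> x)) \<partial>L) = (\<integral>\<^sup>+x. \<phi> x \<partial>L)"
    by (intro nn_integral_cong_AE) (use ae in eventually_elim, auto)
  show int: "integrable L (\<lambda>x. enn2real (\<phi> x))"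
    using fin by (intro integrableI_nonneg) (auto simp: eq)
  show "ennreal (\<integral>x. enn2real (\<phi> x) \<partial>L) = (\<integral>\<^sup>+x. \<phi> x \<partial>L)"
    using nn_integral_eq_integral[OF int] by (simp add: eq)
qed

text \<open>Truncation is only guaranteed to reach levels strictly below the integral. If the
  integral is finite, \<open>\<phi>\<close> itself, made real-valued, attains the level; if it is
  infinite, every real \<open>d\<close> lies strictly below.\<close>

lemma integrable_minorant:
  assumes "finite_measure L" and [measurable]: "\<phi> \<in> borel_measurable L"
    and d: "ennreal d \<le> (\<integral>\<^sup>+x. \<phi> x \<partial>L)"
  shows "\<exists>r. integrable L r \<and> (\<forall>x. 0 \<le> r x \<and> ennreal (r x) \<le> \<phi> x) \<and> d \<le> integral\<^sup>L L r"
proof (cases "(\<integral>\<^sup>+x. \<phi> x \<partial>L) < \<infinity>")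
  case True
  have "ennreal (enn2real (\<phi> x)) \<le> \<phi> x" for x by (cases "\<phi> x") auto
  moreover have "d \<le> (\<integral>x. enn2real (\<phi> x) \<partial>L)"
    using d integrable_enn2real(2)[OF assms(2) True] by (metis ennreal_le_iff integral_nonneg_AE enn2real_nonneg AE_I2)
  ultimately show ?thesis
    using integrable_enn2real(1)[OF assms(2) True] by (intro exI[of _ "\<lambda>x. enn2real (\<phi> x)"]) auto
next
  case False
  then have "ennreal d < (\<integral>\<^sup>+x. \<phi> x \<partial>L)" by (auto simp: not_less top_unique)
  from nn_integral_truncate[OF assms(1,2) this]
  obtain r where r: "integrable L r" "\<forall>x. 0 \<le> r x \<and> ennreal (r x) \<le> \<phi> x" "ennreal d < ennreal (integral\<^sup>L L r)"
    by blast
  have "d \<le> integral\<^sup>L L r"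
  proof (rule ccontr)
    assume "\<not> ?thesis"
    then have "ennreal (integral\<^sup>L L r) \<le> ennreal d" by (intro ennreal_leI) simp
    with r(3) show False by simp
  qed
  with r show ?thesis by blast
qed

section \<open>From measures on an initial segment to atomic measures in an infinite
  universe\<close>

lemma sum_inv_image: "inj \<iota> \<Longrightarrow> (\<Sum>t\<in>\<iota> ` S. a (inv \<iota> t)) = sum a S"
  by (subst sum.reindex) (auto intro: inj_on_subset)

text \<open>The divergence of a finite pair is a sum over atoms, so renaming the atoms by an
  injection leaves it unchanged. One pair serves all generators at once, which keeps objective and
  constraints together.\<close>

lemma embed_finite_pair:
  assumes inf: "infinite (UNIV :: 'a set)"
    and P: "P \<in> prob_measures_upto n" and Q: "Q \<in> prob_measures_upto n"
  shows "\<exists>P' Q'. (P', Q') \<in> (prob_pairs :: ('a measure \<times> 'a measure) set) \<and>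
    (\<forall>f. convex_on {0<..} f \<longrightarrow> f 1 = 0 \<longrightarrow> f_divergence f P' Q' = f_divergence f P Q)"
proof -
  have atoms: "R = density (count_space {1..n}) (\<lambda>j. ennreal (measure R {j}))"
    and total: "(\<Sum>j=1..n. measure R {j}) = 1" if "R \<in> prob_measures_upto n" for R
  proof -
    have R: "prob_space R" "sets R = Pow {1..n}" using that by (auto simp: prob_measures_upto_def)
    interpret R: prob_space R by fact
    have sp: "space R = {1..n}" using sets_eq_imp_space_eq[of R "count_space {1..n}"] R(2) by simp
    show "R = density (count_space {1..n}) (\<lambda>j. ennreal (measure R {j}))"
    proof (rule measure_eqI_finite[where A = "{1..n}"])
      fix j assume "j \<in> {1..n}"
      then show "emeasure R {j} = emeasure (density (count_space {1..n}) (\<lambda>j. ennreal (measure R {j}))) {j}"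
        by (simp add: R.emeasure_eq_measure emeasure_density nn_integral_count_space_finite
            indicator_def if_distrib[of "\<lambda>x. _ * x"] sum.delta cong: if_cong)
    qed (auto simp: R)
    have "measure R {1..n} = (\<Sum>j=1..n. measure R {j})"
      by (rule R.finite_measure_eq_sum_singleton) (auto simp: R)
    then show "(\<Sum>j=1..n. measure R {j}) = 1" using R.prob_space by (simp add: sp)
  qed
  obtain \<iota> :: "nat \<Rightarrow> 'a" where \<iota>: "inj \<iota>" using infinite_countable_subset[OF inf] by blast
  define T where "T = \<iota> ` {1..n}"
  define p q where "p = (\<lambda>t. measure P {inv \<iota> t})" and "q = (\<lambda>t. measure Q {inv \<iota> t})"
  have fT: "finite T" by (simp add: T_def)
  have p: "\<And>t. 0 \<le> p t" "sum p T = 1"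
    using sum_inv_image[OF \<iota>, of "\<lambda>j. measure P {j}" "{1..n}"] total[OF P]
    by (simp_all add: p_def T_def)
  have q: "\<And>t. 0 \<le> q t" "sum q T = 1"
    using sum_inv_image[OF \<iota>, of "\<lambda>j. measure Q {j}" "{1..n}"] total[OF Q]
    by (simp_all add: q_def T_def)
  define P' Q' where "P' = density (count_space T) (\<lambda>t. ennreal (p t))"
    and "Q' = density (count_space T) (\<lambda>t. ennreal (q t))"
  have "(P', Q') \<in> prob_pairs"
    unfolding P'_def Q'_def prob_pairs_def
    using prob_space_density_count_space[OF fT p q] prob_space_density_count_space[OF fT q p] by simp
  moreover have "f_divergence f P' Q' = f_divergence f P Q" if f: "convex_on {0<..} f" "f 1 = 0" for f
  proof -
    have "f_divergence f P' Q' = enn2ereal (\<Sum>t\<in>T. perspective f (p t) (q t))"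
      unfolding P'_def Q'_def by (rule f_divergence_count_space[OF fT p q f])
    also have "(\<Sum>t\<in>T. perspective f (p t) (q t))
        = (\<Sum>j=1..n. perspective f (measure P {j}) (measure Q {j}))"
      unfolding p_def q_def T_def
      by (rule sum_inv_image[OF \<iota>, of "\<lambda>j. perspective f (measure P {j}) (measure Q {j})"])
    also have "enn2ereal \<dots> = f_divergence f P Q"
      using f_divergence_count_space[of "{1..n}" "\<lambda>j. measure P {j}" "\<lambda>j. measure Q {j}", OF _ _ total[OF P] _ total[OF Q] f]
        atoms[OF P] atoms[OF Q] by simp
    finally show ?thesis .
  qed
  ultimately show ?thesis by blast
qed

text \<open>The step common to the supremum and the infimum. Each problem inserts its own
  \<open>r\<close> and \<open>G\<close>; the divergences of the new pair are given as explicit sums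
  for every generator, to be compared with \<open>r\<close> and \<open>G\<close> at the
  atoms.\<close>

lemma finite_reduction:
  fixes L :: "'x measure"
  assumes L: "finite_measure L" "emeasure L (space L) \<noteq> 0"
    and p [measurable]: "p \<in> borel_measurable L" and p0: "\<And>x. 0 \<le> p x"
    and q [measurable]: "q \<in> borel_measurable L" and q0: "\<And>x. 0 \<le> q x"
    and P: "P = density L (\<lambda>x. ennreal (p x))" and Q: "Q = density L (\<lambda>x. ennreal (q x))"
    and PQ: "prob_space P" "prob_space Q"
    and pos: "AE x in L. 0 < p x + q x"
    and r: "\<And>i. i \<in> {1..m} \<Longrightarrow> integrable L (r i)" and G: "integrable L G"
    and \<Omega> [measurable]: "\<Omega> \<in> sets L" and AE\<Omega>: "AE x in L. x \<in> \<Omega>"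
  shows "\<exists>P'\<in>prob_measures_upto (m + 2). \<exists>Q'\<in>prob_measures_upto (m + 2). \<exists>s w.
    (\<forall>j\<in>{1..m+2}. s j \<in> \<Omega> \<and> 0 \<le> w j) \<and>
    (\<forall>i\<in>{1..m}. (\<Sum>j=1..m+2. w j * r i (s j)) = integral\<^sup>L L (r i)) \<and>
    integral\<^sup>L L G \<le> (\<Sum>j=1..m+2. w j * G (s j)) \<and>
    (\<forall>f. convex_on {0<..} f \<longrightarrow> f 1 = 0 \<longrightarrow> f_divergence f P' Q' =
      enn2ereal (\<Sum>j=1..m+2. ennreal (w j) * perspective f (p (s j)) (q (s j))))"
proof -
  note ip = integral_prob_density[OF p p0 P PQ(1)] and iq = integral_prob_density[OF q q0 Q PQ(2)]
  \<comment> \<open>Coordinate 0 must be positive, hence \<open>p + q\<close>; with \<open>p\<close>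
    as the last coordinate, the integral of \<open>q\<close> is preserved as a difference.\<close>
  define h where "h = (\<lambda>i. if i = 0 then (\<lambda>x. p x + q x) else if i = m + 1 then p else r i)"
  define \<Omega>' where "\<Omega>' = {x\<in>\<Omega>. 0 < p x + q x}"
  have "\<Omega>' = \<Omega> \<inter> {x\<in>space L. 0 < p x + q x}"
    using sets.sets_into_space[OF \<Omega>] by (auto simp: \<Omega>'_def)
  then have \<Omega>': "\<Omega>' \<in> sets L" by simp
  have "\<exists>s w. (\<forall>j\<in>{1..m+2}. s j \<in> \<Omega>' \<and> 0 \<le> w j) \<and>
    (\<forall>i<m+2. (\<Sum>j=1..m+2. w j * h i (s j)) = integral\<^sup>L L (h i)) \<and>
    integral\<^sup>L L G \<le> (\<Sum>j=1..m+2. w j * G (s j))"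
  proof (rule finite_representation[OF L])
    show "AE x in L. x \<in> \<Omega>'" using AE\<Omega> pos by eventually_elim (simp add: \<Omega>'_def)
    show "0 < h 0 x" if "x \<in> \<Omega>'" for x using that by (simp add: \<Omega>'_def h_def)
    show "integrable L (h i)" if im: "i < m + 2" for i
    proof -
      consider "i = 0" | "i = m + 1" | "i \<in> {1..m}" using im by force
      then show ?thesis using r ip iq by cases (auto simp: h_def)
    qed
  qed (use \<Omega>' G in auto)
  then obtain s w where sw: "\<And>j. j \<in> {1..m+2} \<Longrightarrow> s j \<in> \<Omega>' \<and> 0 \<le> w j"
    and hs: "\<And>i. i < m+2 \<Longrightarrow> (\<Sum>j=1..m+2. w j * h i (s j)) = integral\<^sup>L L (h i)"
    and Gs: "integral\<^sup>L L G \<le> (\<Sum>j=1..m+2. w j * G (s j))" by blast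
  \<comment> \<open>Extension by 0, since the facts on finite counting measures ask for
    nonnegativity at every index.\<close>
  define u where "u = (\<lambda>j. if j \<in> {1..m+2} then w j else 0)"
  have u0: "0 \<le> u j" for j using sw by (simp add: u_def)
  have uw: "(\<Sum>j=1..m+2. u j * a j) = (\<Sum>j=1..m+2. w j * a j)" for a
    by (intro sum.cong) (auto simp: u_def)
  have sp: "(\<Sum>j=1..m+2. u j * p (s j)) = 1"
    using hs[of "m + 1"] ip unfolding uw by (simp add: h_def)
  have "(\<Sum>j=1..m+2. u j * (p (s j) + q (s j))) = 2"
    using hs[of 0] ip iq unfolding uw by (simp add: h_def)
  then have sq: "(\<Sum>j=1..m+2. u j * q (s j)) = 1"
    using sp unfolding distrib_left sum.distrib by linarith
  define P' Q' where "P' = density (count_space {1..m+2}) (\<lambda>j. ennreal (u j * p (s j)))"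
    and "Q' = density (count_space {1..m+2}) (\<lambda>j. ennreal (u j * q (s j)))"
  have up: "\<And>j. 0 \<le> u j * p (s j)" and uq: "\<And>j. 0 \<le> u j * q (s j)" using u0 p0 q0 by auto
  have fin: "finite {1..m+2}" by simp
  have PQ': "P' \<in> prob_measures_upto (m+2)" "Q' \<in> prob_measures_upto (m+2)"
    unfolding P'_def Q'_def prob_measures_upto_def
    using prob_space_density_count_space[OF fin up sp uq sq] prob_space_density_count_space[OF fin uq sq up sp]
    by auto
  have "f_divergence f P' Q' =
      enn2ereal (\<Sum>j=1..m+2. ennreal (w j) * perspective f (p (s j)) (q (s j)))"
    if f: "convex_on {0<..} f" "f 1 = 0" for f
  proof -
    have "f_divergence f P' Q' = enn2ereal (\<Sum>j=1..m+2. perspective f (u j * p (s j)) (u j * q (s j)))"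
      unfolding P'_def Q'_def by (rule f_divergence_count_space[OF fin up sp uq sq f])
    also have "(\<Sum>j=1..m+2. perspective f (u j * p (s j)) (u j * q (s j)))
        = (\<Sum>j=1..m+2. ennreal (w j) * perspective f (p (s j)) (q (s j)))"
    proof (rule sum.cong)
      fix j assume "j \<in> {1..m+2}"
      then show "perspective f (u j * p (s j)) (u j * q (s j)) = ennreal (w j) * perspective f (p (s j)) (q (s j))"
        using perspective_scale[OF u0 p0 q0, of f j "s j" "s j"] by (simp add: u_def)
    qed simp
    finally show ?thesis .
  qed
  moreover have "(\<Sum>j=1..m+2. w j * r i (s j)) = integral\<^sup>L L (r i)" if "i \<in> {1..m}" for i
    using hs[of i] that by (simp add: h_def)
  ultimately show ?thesis
    using PQ' sw Gs by (intro bexI[of _ P'] bexI[of _ Q'] exI[of _ s] exI[of _ w]) (auto simp: \<Omega>'_def)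
qed

lemma prob_pair_perspective:
  assumes "(P, Q) \<in> (prob_pairs :: ('a measure \<times> 'a measure) set)"
  obtains L :: "'a measure" and p q :: "'a \<Rightarrow> real" where
    "finite_measure L" "emeasure L (space L) \<noteq> 0"
    "p \<in> borel_measurable L" "\<And>x. 0 \<le> p x" "q \<in> borel_measurable L" "\<And>x. 0 \<le> q x"
    "P = density L (\<lambda>x. ennreal (p x))" "Q = density L (\<lambda>x. ennreal (q x))"
    "prob_space P" "prob_space Q" "AE x in L. 0 < p x + q x"
    "\<And>f. convex_on {0<..} f \<Longrightarrow> f 1 = 0 \<Longrightarrow>
      f_divergence f P Q = enn2ereal (\<integral>\<^sup>+x. perspective f (p x) (q x) \<partial>L)"
proof -
  have PQ: "prob_space P" "prob_space Q" "sets P = sets Q" using assms by (auto simp: prob_pairs_def)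
  obtain L p q where *:
    "finite_measure L" "emeasure L (space L) \<noteq> 0"
    "p \<in> borel_measurable L" "\<And>x. 0 \<le> p x" "q \<in> borel_measurable L" "\<And>x. 0 \<le> q x"
    "P = density L (\<lambda>x. ennreal (p x))" "Q = density L (\<lambda>x. ennreal (q x))"
    "AE x in L. 0 < p x + q x"
    using prob_pair_densities[OF PQ] by blast
  have sf: "sigma_finite_measure L" using *(1) by (rule finite_measure.axioms)
  show ?thesis
    by (rule that[OF *(1-8) PQ(1,2) *(9)])
      (rule f_divergence_perspective[OF _ _ sf *(3-8) PQ(1,2)])
qed

section \<open>The two extremal problems on \<open>m + 2\<close> atoms\<close>

text \<open>Finite constraint divergences have integrable integrands and are reproduced exactly. The
  objective may be infinite, so only a real level \<open>d\<close> is tracked, through a minorant of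
  its integrand with integral at least \<open>d\<close>.\<close>

lemma finite_pair_larger_divergence:
  assumes f: "convex_on {0<..} f" "f 1 = 0"
    and fs: "\<And>i. i \<in> {1..m} \<Longrightarrow> convex_on {0<..} (fs i)" "\<And>i. i \<in> {1..m} \<Longrightarrow> fs i 1 = 0"
    and PQ: "(P, Q) \<in> prob_pairs"
    and fin: "\<And>i. i \<in> {1..m} \<Longrightarrow> f_divergence (fs i) P Q < \<infinity>"
    and d: "0 \<le> d" "ereal d \<le> f_divergence f P Q"
  shows "\<exists>P'\<in>prob_measures_upto (m + 2). \<exists>Q'\<in>prob_measures_upto (m + 2).
    (\<forall>i\<in>{1..m}. f_divergence (fs i) P' Q' = f_divergence (fs i) P Q) \<and> ereal d \<le> f_divergence f P' Q'"
proof -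
  obtain L p q where L: "finite_measure L" "emeasure L (space L) \<noteq> 0"
    "p \<in> borel_measurable L" "\<And>x. 0 \<le> p x" "q \<in> borel_measurable L" "\<And>x. 0 \<le> q x"
    "P = density L (\<lambda>x. ennreal (p x))" "Q = density L (\<lambda>x. ennreal (q x))"
    "prob_space P" "prob_space Q" "AE x in L. 0 < p x + q x"
    and div: "\<And>f. convex_on {0<..} f \<Longrightarrow> f 1 = 0 \<Longrightarrow>
      f_divergence f P Q = enn2ereal (\<integral>\<^sup>+x. perspective f (p x) (q x) \<partial>L)"
    using prob_pair_perspective[OF PQ] by blast
  define \<phi> where "\<phi> = (\<lambda>x. perspective f (p x) (q x))"
  define \<psi> where "\<psi> = (\<lambda>i x. perspective (fs i) (p x) (q x))"
  have [measurable]: "\<phi> \<in> borel_measurable L"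
    unfolding \<phi>_def by (rule borel_measurable_perspective[OF f L(3,5)])
  have m\<psi>: "\<psi> i \<in> borel_measurable L" if "i \<in> {1..m}" for i
    unfolding \<psi>_def by (rule borel_measurable_perspective[OF fs(1)[OF that] fs(2)[OF that] L(3,5)])
  have \<psi>fin: "(\<integral>\<^sup>+x. \<psi> i x \<partial>L) < \<infinity>" if "i \<in> {1..m}" for i
    using fin[OF that] div[OF fs(1)[OF that] fs(2)[OF that]] by (simp add: \<psi>_def less_ennreal.rep_eq)
  have "ennreal d \<le> (\<integral>\<^sup>+x. \<phi> x \<partial>L)"
    using d div[OF f] by (simp add: \<phi>_def less_eq_ennreal.rep_eq)
  then obtain G where G: "integrable L G" "\<forall>x. 0 \<le> G x \<and> ennreal (G x) \<le> \<phi> x" "d \<le> integral\<^sup>L L G"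
    using integrable_minorant[OF L(1), of \<phi> d] by auto
  \<comment> \<open>Atoms must avoid infinite constraint integrands, which \<open>enn2real\<close>
    would turn into 0.\<close>
  define \<Omega> where "\<Omega> = {x\<in>space L. \<forall>i\<in>{1..m}. \<psi> i x < \<infinity>}"
  note [measurable] = m\<psi>
  have \<Omega>: "\<Omega> \<in> sets L" unfolding \<Omega>_def by measurable
  have "AE x in L. \<forall>i\<in>{1..m}. \<psi> i x < \<infinity>"
    by (rule AE_finite_allI) (use integrable_enn2real(3)[OF m\<psi> \<psi>fin] in auto)
  with AE_space have AE\<Omega>: "AE x in L. x \<in> \<Omega>" by eventually_elim (simp add: \<Omega>_def)
  obtain P' Q' s w where PQ': "P' \<in> prob_measures_upto (m + 2)" "Q' \<in> prob_measures_upto (m + 2)"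
    and sw': "\<forall>j\<in>{1..m+2}. s j \<in> \<Omega> \<and> 0 \<le> w j"
    and rs': "\<forall>i\<in>{1..m}.
      (\<Sum>j=1..m+2. w j * enn2real (\<psi> i (s j))) = (\<integral>x. enn2real (\<psi> i x) \<partial>L)"
    and Gs: "integral\<^sup>L L G \<le> (\<Sum>j=1..m+2. w j * G (s j))"
    and div'': "\<forall>f. convex_on {0<..} f \<longrightarrow> f 1 = 0 \<longrightarrow> f_divergence f P' Q' =
      enn2ereal (\<Sum>j=1..m+2. ennreal (w j) * perspective f (p (s j)) (q (s j)))"
    using finite_reduction[where r = "\<lambda>i x. enn2real (\<psi> i x)",
        OF L integrable_enn2real(1)[OF m\<psi> \<psi>fin] G(1) \<Omega> AE\<Omega>]
    by blast
  note sw = sw'[rule_format] and rs = rs'[rule_format] and div' = div''[rule_format]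
  have "f_divergence (fs i) P' Q' = f_divergence (fs i) P Q" if i: "i \<in> {1..m}" for i
  proof -
    have "(\<Sum>j=1..m+2. ennreal (w j) * \<psi> i (s j)) = (\<Sum>j=1..m+2. ennreal (w j * enn2real (\<psi> i (s j))))"
    proof (rule sum.cong)
      fix j assume j: "j \<in> {1..m+2}"
      then have "\<psi> i (s j) < top" using sw i by (auto simp: \<Omega>_def)
      then show "ennreal (w j) * \<psi> i (s j) = ennreal (w j * enn2real (\<psi> i (s j)))"
        using sw[OF j] by (simp add: ennreal_mult)
    qed simp
    also have "\<dots> = ennreal (\<integral>x. enn2real (\<psi> i x) \<partial>L)"
      using sw rs[OF i] by (subst sum_ennreal) auto
    also have "\<dots> = (\<integral>\<^sup>+x. \<psi> i x \<partial>L)" by (rule integrable_enn2real(2)[OF m\<psi>[OF i] \<psi>fin[OF i]])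
    finally show ?thesis
      using div[OF fs(1)[OF i] fs(2)[OF i]] div'[OF fs(1)[OF i] fs(2)[OF i]] by (simp add: \<psi>_def)
  qed
  moreover have "ereal d \<le> f_divergence f P' Q'"
  proof -
    have "ennreal d \<le> ennreal (\<Sum>j=1..m+2. w j * G (s j))" using G(3) Gs by (intro ennreal_leI) simp
    also have "\<dots> = (\<Sum>j=1..m+2. ennreal (w j * G (s j)))"
      using sw G(2) by (intro sum_ennreal[symmetric]) auto
    also have "\<dots> \<le> (\<Sum>j=1..m+2. ennreal (w j) * \<phi> (s j))"
      using sw G(2) by (intro sum_mono) (auto simp: ennreal_mult intro!: mult_left_mono)
    finally show ?thesis
      using div'[OF f] d(1) by (simp add: \<phi>_def less_eq_ennreal.rep_eq)
  qed
  ultimately show ?thesis using PQ' by blast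
qed

text \<open>With the objective finite, the constraints are the possibly infinite quantities.
  Minorants with integrals at least \<open>D i\<close> are reproduced exactly and stay below the
  constraint integrands at each atom, so the new divergences remain at least
  \<open>D i\<close>.\<close>

lemma finite_pair_smaller_divergence:
  assumes f: "convex_on {0<..} f" "f 1 = 0"
    and fs: "\<And>i. i \<in> {1..m} \<Longrightarrow> convex_on {0<..} (fs i)" "\<And>i. i \<in> {1..m} \<Longrightarrow> fs i 1 = 0"
    and PQ: "(P, Q) \<in> prob_pairs"
    and D: "\<And>i. i \<in> {1..m} \<Longrightarrow> 0 \<le> D i" "\<And>i. i \<in> {1..m} \<Longrightarrow> ereal (D i) \<le> f_divergence (fs i) P Q"
    and fin: "f_divergence f P Q < \<infinity>"
  shows "\<exists>P'\<in>prob_measures_upto (m + 2). \<exists>Q'\<in>prob_measures_upto (m + 2).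
    (\<forall>i\<in>{1..m}. ereal (D i) \<le> f_divergence (fs i) P' Q') \<and> f_divergence f P' Q' \<le> f_divergence f P Q"
proof -
  obtain L p q where L: "finite_measure L" "emeasure L (space L) \<noteq> 0"
    "p \<in> borel_measurable L" "\<And>x. 0 \<le> p x" "q \<in> borel_measurable L" "\<And>x. 0 \<le> q x"
    "P = density L (\<lambda>x. ennreal (p x))" "Q = density L (\<lambda>x. ennreal (q x))"
    "prob_space P" "prob_space Q" "AE x in L. 0 < p x + q x"
    and div: "\<And>f. convex_on {0<..} f \<Longrightarrow> f 1 = 0 \<Longrightarrow>
      f_divergence f P Q = enn2ereal (\<integral>\<^sup>+x. perspective f (p x) (q x) \<partial>L)"
    using prob_pair_perspective[OF PQ] by blast
  define \<phi> where "\<phi> = (\<lambda>x. perspective f (p x) (q x))"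
  define \<psi> where "\<psi> = (\<lambda>i x. perspective (fs i) (p x) (q x))"
  have m\<phi> [measurable]: "\<phi> \<in> borel_measurable L"
    unfolding \<phi>_def by (rule borel_measurable_perspective[OF f L(3,5)])
  have \<phi>fin: "(\<integral>\<^sup>+x. \<phi> x \<partial>L) < \<infinity>"
    using fin div[OF f] by (simp add: \<phi>_def less_ennreal.rep_eq)
  have "\<exists>r. integrable L r \<and> (\<forall>x. 0 \<le> r x \<and> ennreal (r x) \<le> \<psi> i x) \<and> D i \<le> integral\<^sup>L L r"
    if i: "i \<in> {1..m}" for i
  proof (rule integrable_minorant[OF L(1)])
    show "\<psi> i \<in> borel_measurable L"
      unfolding \<psi>_def by (rule borel_measurable_perspective[OF fs(1)[OF i] fs(2)[OF i] L(3,5)])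
    show "ennreal (D i) \<le> (\<integral>\<^sup>+x. \<psi> i x \<partial>L)"
      using D[OF i] div[OF fs(1)[OF i] fs(2)[OF i]] by (simp add: \<psi>_def less_eq_ennreal.rep_eq)
  qed
  then obtain r where r: "\<And>i. i \<in> {1..m} \<Longrightarrow> integrable L (r i)"
    "\<And>i x. i \<in> {1..m} \<Longrightarrow> 0 \<le> r i x \<and> ennreal (r i x) \<le> \<psi> i x"
    "\<And>i. i \<in> {1..m} \<Longrightarrow> D i \<le> integral\<^sup>L L (r i)"
    by metis
  define \<Omega> where "\<Omega> = {x\<in>space L. \<phi> x < \<infinity>}"
  have \<Omega>: "\<Omega> \<in> sets L" unfolding \<Omega>_def by measurable
  have AE\<Omega>: "AE x in L. x \<in> \<Omega>"
    using AE_space integrable_enn2real(3)[OF m\<phi> \<phi>fin] by eventually_elim (simp add: \<Omega>_def)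
  \<comment> \<open>The reduction never decreases its objective, so the negative of the integrand is
    passed to it.\<close>
  have G: "integrable L (\<lambda>x. - enn2real (\<phi> x))" using integrable_enn2real(1)[OF m\<phi> \<phi>fin] by simp
  obtain P' Q' s w where PQ': "P' \<in> prob_measures_upto (m + 2)" "Q' \<in> prob_measures_upto (m + 2)"
    and sw': "\<forall>j\<in>{1..m+2}. s j \<in> \<Omega> \<and> 0 \<le> w j"
    and rs': "\<forall>i\<in>{1..m}. (\<Sum>j=1..m+2. w j * r i (s j)) = integral\<^sup>L L (r i)"
    and Gs: "(\<integral>x. - enn2real (\<phi> x) \<partial>L) \<le> (\<Sum>j=1..m+2. w j * - enn2real (\<phi> (s j)))"
    and div'': "\<forall>f. convex_on {0<..} f \<longrightarrow> f 1 = 0 \<longrightarrow> f_divergence f P' Q' =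
      enn2ereal (\<Sum>j=1..m+2. ennreal (w j) * perspective f (p (s j)) (q (s j)))"
    using finite_reduction[where r = r, OF L r(1) G \<Omega> AE\<Omega>] by blast
  note sw = sw'[rule_format] and rs = rs'[rule_format] and div' = div''[rule_format]
  have "ereal (D i) \<le> f_divergence (fs i) P' Q'" if i: "i \<in> {1..m}" for i
  proof -
    have "ennreal (D i) \<le> ennreal (\<Sum>j=1..m+2. w j * r i (s j))"
      using r(3)[OF i] rs[OF i] by (intro ennreal_leI) simp
    also have "\<dots> = (\<Sum>j=1..m+2. ennreal (w j * r i (s j)))"
      using sw r(2)[OF i] by (intro sum_ennreal[symmetric]) auto
    also have "\<dots> \<le> (\<Sum>j=1..m+2. ennreal (w j) * \<psi> i (s j))"
      using sw r(2)[OF i] by (intro sum_mono) (auto simp: ennreal_mult intro!: mult_left_mono)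
    finally show ?thesis
      using div'[OF fs(1)[OF i] fs(2)[OF i]] D(1)[OF i] by (simp add: \<psi>_def less_eq_ennreal.rep_eq)
  qed
  moreover have "f_divergence f P' Q' \<le> f_divergence f P Q"
  proof -
    have "(\<Sum>j=1..m+2. ennreal (w j) * \<phi> (s j)) = (\<Sum>j=1..m+2. ennreal (w j * enn2real (\<phi> (s j))))"
    proof (rule sum.cong)
      fix j assume j: "j \<in> {1..m+2}"
      then have "\<phi> (s j) < top" using sw by (auto simp: \<Omega>_def)
      then show "ennreal (w j) * \<phi> (s j) = ennreal (w j * enn2real (\<phi> (s j)))"
        using sw[OF j] by (simp add: ennreal_mult)
    qed simp
    also have "\<dots> = ennreal (\<Sum>j=1..m+2. w j * enn2real (\<phi> (s j)))"
      using sw by (intro sum_ennreal) auto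
    also have "\<dots> \<le> ennreal (\<integral>x. enn2real (\<phi> x) \<partial>L)"
      using Gs by (intro ennreal_leI) (simp add: sum_negf)
    also have "\<dots> = (\<integral>\<^sup>+x. \<phi> x \<partial>L)" by (rule integrable_enn2real(2)[OF m\<phi> \<phi>fin])
    finally show ?thesis
      using div[OF f] div'[OF f] by (simp add: \<phi>_def less_eq_ennreal.rep_eq)
  qed
  ultimately show ?thesis using PQ' by blast
qed

text \<open>An infinite \<open>'a\<close> has room for a copy of every finite pair, which gives one
  inequality in each equality. The right-hand sides do not mention \<open>'a\<close>, so the
  supremum is the same over every infinite universe of points.\<close>

theorem theorem2p1:
  fixes m :: nat
    and f :: "real \<Rightarrow> real"
    and fs :: "nat \<Rightarrow> real \<Rightarrow> real"
    and D :: "nat \<Rightarrow> real"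
  assumes "m \<ge> 1"
    and "convex_on {0<..} f" and "f 1 = 0"
    and "\<And>i. i \<in> {1..m} \<Longrightarrow> convex_on {0<..} (fs i)"
    and "\<And>i. i \<in> {1..m} \<Longrightarrow> fs i 1 = 0"
    and "\<And>i. i \<in> {1..m} \<Longrightarrow> D i \<ge> 0"
    and "infinite (UNIV :: 'a set)"
  shows "constrained_sup (prob_pairs :: ('a measure \<times> 'a measure) set) f m fs D = A_n (m + 2) f m fs D \<and>
    ((\<forall>i\<in>{1..m}. divergence_finite_on (prob_pairs :: ('a measure \<times> 'a measure) set) (fs i)) \<longrightarrow>
      constrained_inf (prob_pairs :: ('a measure \<times> 'a measure) set) f m fs D = B_n (m + 2) f m fs D)"
proof (intro conjI impI)
  let ?K = "prob_pairs :: ('a measure \<times> 'a measure) set"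
  let ?U = "prob_measures_upto (m + 2)"
  note f = assms(2,3) and fs = assms(4,5)
  have embed: "\<exists>P' Q'. (P', Q') \<in> ?K \<and> f_divergence f P' Q' = f_divergence f P Q \<and>
      (\<forall>i\<in>{1..m}. f_divergence (fs i) P' Q' = f_divergence (fs i) P Q)"
    if "P \<in> ?U" "Q \<in> ?U" for P Q
    using embed_finite_pair[OF assms(7) that] f fs by blast
  show "constrained_sup ?K f m fs D = A_n (m + 2) f m fs D"
  proof (rule antisym)
    show "A_n (m + 2) f m fs D \<le> constrained_sup ?K f m fs D"
      unfolding A_n_def constrained_sup_def
    proof (rule Sup_subset_mono, rule subsetI)
      fix x assume "x \<in> {f_divergence f P Q | P Q. (P, Q) \<in> ?U \<times> ?U \<and>
        (\<forall>i\<in>{1..m}. f_divergence (fs i) P Q \<le> ereal (D i))}"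
      then obtain P Q where "x = f_divergence f P Q" "P \<in> ?U" "Q \<in> ?U"
        "\<forall>i\<in>{1..m}. f_divergence (fs i) P Q \<le> ereal (D i)" by auto
      with embed[of P Q] show "x \<in> {f_divergence f P Q | P Q. (P, Q) \<in> ?K \<and>
        (\<forall>i\<in>{1..m}. f_divergence (fs i) P Q \<le> ereal (D i))}" by (clarsimp, metis)
    qed
    show "constrained_sup ?K f m fs D \<le> A_n (m + 2) f m fs D"
      unfolding constrained_sup_def[of ?K]
    proof (rule Sup_least, clarify)
      fix P Q :: "'a measure" assume PQ: "(P, Q) \<in> ?K"
        and feas: "\<forall>i\<in>{1..m}. f_divergence (fs i) P Q \<le> ereal (D i)"
      \<comment> \<open>The real bounds \<open>D i\<close> are what makes the constraint integrands
        integrable.\<close>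
      have fin: "f_divergence (fs i) P Q < \<infinity>" if "i \<in> {1..m}" for i
        by (rule le_less_trans[OF bspec[OF feas that]]) simp
      \<comment> \<open>Working with real levels below the divergence also covers the value
        \<open>\<infinity>\<close>; levels \<open>d \<ge> 0\<close> suffice because the divergence
        is nonnegative, as \<open>X\<close> shows.\<close>
      have le: "ereal d \<le> A_n (m + 2) f m fs D" if d: "0 \<le> d" "ereal d \<le> f_divergence f P Q" for d
      proof -
        obtain P' Q' where P': "P' \<in> ?U" "Q' \<in> ?U" "ereal d \<le> f_divergence f P' Q'"
          "\<forall>i\<in>{1..m}. f_divergence (fs i) P' Q' = f_divergence (fs i) P Q"
          using finite_pair_larger_divergence[where m = m and fs = fs, OF f fs PQ fin d] by blast
        have "\<forall>i\<in>{1..m}. f_divergence (fs i) P' Q' \<le> ereal (D i)" using feas P'(4) by simp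
        then have "f_divergence f P' Q' \<le> A_n (m + 2) f m fs D"
          unfolding A_n_def constrained_sup_def by (intro Sup_upper) (use P'(1,2) in blast)
        with P'(3) show ?thesis by (rule order_trans)
      qed
      obtain X where X: "f_divergence f P Q = enn2ereal X"
        by (rule prob_pair_perspective[OF PQ]) (use f that in blast)
      show "f_divergence f P Q \<le> A_n (m + 2) f m fs D"
      proof (cases X)
        case (real x)
        then show ?thesis using le[of x] X by simp
      next
        case top
        have "ereal b \<le> A_n (m + 2) f m fs D" for b
          by (rule order_trans[OF _ le[of "max 0 b"]]) (simp_all add: X top)
        then have "A_n (m + 2) f m fs D = \<infinity>" by (rule ereal_top)
        then show ?thesis by simp
      qed
    qed
  qed
  show "constrained_inf ?K f m fs D = B_n (m + 2) f m fs D"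
  proof (rule antisym)
    show "constrained_inf ?K f m fs D \<le> B_n (m + 2) f m fs D"
      unfolding B_n_def constrained_inf_def
    proof (rule Inf_superset_mono, rule subsetI)
      fix x assume "x \<in> {f_divergence f P Q | P Q. (P, Q) \<in> ?U \<times> ?U \<and>
        (\<forall>i\<in>{1..m}. ereal (D i) \<le> f_divergence (fs i) P Q)}"
      then obtain P Q where "x = f_divergence f P Q" "P \<in> ?U" "Q \<in> ?U"
        "\<forall>i\<in>{1..m}. ereal (D i) \<le> f_divergence (fs i) P Q" by auto
      with embed[of P Q] show "x \<in> {f_divergence f P Q | P Q. (P, Q) \<in> ?K \<and>
        (\<forall>i\<in>{1..m}. ereal (D i) \<le> f_divergence (fs i) P Q)}" by (clarsimp, metis)
    qed
    show "B_n (m + 2) f m fs D \<le> constrained_inf ?K f m fs D"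
      unfolding constrained_inf_def[of ?K]
    proof (rule Inf_greatest, clarify)
      fix P Q :: "'a measure" assume PQ: "(P, Q) \<in> ?K"
        and feas: "\<forall>i\<in>{1..m}. ereal (D i) \<le> f_divergence (fs i) P Q"
      show "B_n (m + 2) f m fs D \<le> f_divergence f P Q"
      \<comment> \<open>An infinite objective bounds everything from above, so a finite pair is
        needed only in the other case.\<close>
      proof (cases "f_divergence f P Q < \<infinity>")
        case True
        obtain P' Q' where P': "P' \<in> ?U" "Q' \<in> ?U" "f_divergence f P' Q' \<le> f_divergence f P Q"
          "\<forall>i\<in>{1..m}. ereal (D i) \<le> f_divergence (fs i) P' Q'"
          using finite_pair_smaller_divergence[where m = m and fs = fs and D = D,
              OF f fs PQ assms(6) feas[rule_format] True]
          by blast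
        have "B_n (m + 2) f m fs D \<le> f_divergence f P' Q'"
          unfolding B_n_def constrained_inf_def by (intro Inf_lower) (use P'(1,2,4) in blast)
        then show ?thesis using P'(3) by (rule order_trans)
      qed simp
    qed
  qed
qed

end
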